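(* Let $\lambda\ge3$. There is a constant $C>0$, which may depend on $\lambda$ but is independent of $\varepsilon$ and of the discrete spaces, such that the following holds. Let $0<\varepsilon\le1$, $f\in L_2(\Omega)$, and let $u$ be the solution of $$\varepsilon^4u^{(4)}+4u=f\ \text{ in }\Omega=(0,1),\qquad u(\xi)=u'(\xi)=0,\ \xi\in\{0,1\}.$$ Let $V_h=V_h^u\times V_h^v$ be a finite-dimensional subspace of $V$ and let $(u_h,v_h)\in V_h$ satisfy $\mathcal{B}\bigl((u_h,v_h),(u_*,v_* )\bigr)=\mathcal{F}\bigl((u_*,v_* )\bigr)$ for all $(u_*,v_* )\in V_h$. Then $$|||(u-u_h,\varepsilon^{3/2}u''-v_h)|||\le C\inf_{(u_*,v_* )\in V_h}|||(u-u_*,\varepsilon^{3/2}u''-v_* )|||$$ and $$|||(u-u_h,\varepsilon^{3/2}u''-v_h)|||\le C\inf_{(u_*,v_* )\in V_h}|||(u-u_*,\varepsilon^{3/2}u''-v_* )|||\le C\inf_{u_*\in V_h^u}\left\{\|u-u_*\|+\varepsilon^{3/2}\|(u-u_* )''\|\right\}+C\varepsilon^{3/2}\inf_{v_*\in V_h^v}\left\{\|u''-v_*\|+\varepsilon^2\|u^{(4)}-v_*''\|\right\}.$$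
   Context: $\Omega=(0,1)$; $\langle\cdot,\cdot\rangle$ and $\|\cdot\|$ are the $L_2(\Omega)$ inner product and norm. $V:=H_0^2(\Omega)\times H^2(\Omega)$, where $H^2_0(\Omega)$ is the space of $w\in H^2(\Omega)$ with $w=w'=0$ at $0$ and $1$; $V_h^u\subset H_0^2(\Omega)$ and $V_h^v\subset H^2(\Omega)$ are linear subspaces. $$\mathcal{B}\bigl((u,v),(u_*,v_* )\bigr):=\lambda\langle v-\varepsilon^{3/2}u'',v_*-\varepsilon^{3/2}u_*''\rangle+\langle\varepsilon^{5/2}v''+4u,\varepsilon^{3/2}v_*''+4u_*\rangle,\qquad \mathcal{F}\bigl((u_*,v_* )\bigr):=\langle f,\varepsilon^{3/2}v_*''+4u_*\rangle .$$ Balanced norm on $V$: $|||(u,v)|||^2:=\|u\|^2+\varepsilon^3\|u''\|^2+\|v\|^2+\varepsilon^4\|v''\|^2$. As usual, $C$ is a generic constant that may take different values at different occurrences. *)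

theory Defs
  imports "HOL-Analysis.Analysis"
begin

abbreviation Omega :: "real set" where
  "Omega \<equiv> {0<..<1}"

text \<open>Elements of \<open>L\<^sub>2\<close> and of the Sobolev spaces are represented by functions; two functions
  agreeing almost everywhere on \<open>Omega\<close> represent the same element.\<close>

definition L2 :: "(real \<Rightarrow> real) set" where
  "L2 = {f \<in> borel_measurable (lebesgue_on Omega). integrable (lebesgue_on Omega) (\<lambda>x. (f x)\<^sup>2)}"

definition l2_inner :: "(real \<Rightarrow> real) \<Rightarrow> (real \<Rightarrow> real) \<Rightarrow> real" where
  "l2_inner f g = integral\<^sup>L (lebesgue_on Omega) (\<lambda>x. f x * g x)"

definition l2_norm :: "(real \<Rightarrow> real) \<Rightarrow> real" where
  "l2_norm f = sqrt (l2_inner f f)"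

definition test_fun :: "(real \<Rightarrow> real) \<Rightarrow> bool" where
  "test_fun \<phi> \<longleftrightarrow> (\<forall>n x. ((deriv ^^ n) \<phi>) differentiable (at x)) \<and>
     compact (closure {x. \<phi> x \<noteq> 0}) \<and> closure {x. \<phi> x \<noteq> 0} \<subseteq> Omega"

definition weak_deriv :: "nat \<Rightarrow> (real \<Rightarrow> real) \<Rightarrow> (real \<Rightarrow> real) \<Rightarrow> bool" where
  "weak_deriv k w g \<longleftrightarrow> w \<in> L2 \<and> g \<in> L2 \<and>
     (\<forall>\<phi>. test_fun \<phi> \<longrightarrow> l2_inner w ((deriv ^^ k) \<phi>) = (-1) ^ k * l2_inner g \<phi>)"

definition sobolev :: "nat \<Rightarrow> (real \<Rightarrow> real) set" where
  "sobolev k = {w \<in> L2. \<forall>j\<le>k. \<exists>g. weak_deriv j w g}"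

text \<open>Weak derivatives are unique up to null sets. The representative chosen here is arbitrary, and
  \<open>wderiv\<close> is only used under integrals or almost everywhere.\<close>

definition wderiv :: "nat \<Rightarrow> (real \<Rightarrow> real) \<Rightarrow> (real \<Rightarrow> real)" where
  "wderiv k w = (SOME g. weak_deriv k w g)"

text \<open>The boundary values are those of the representative that is continuously differentiable up
  to the boundary.\<close>

definition H02 :: "(real \<Rightarrow> real) set" where
  "H02 = {w \<in> sobolev 2. \<exists>W W'.
     (AE x in lebesgue_on Omega. w x = W x) \<and>
     (\<forall>x\<in>{0..1}. (W has_real_derivative W' x) (at x within {0..1})) \<and>
     continuous_on {0..1} W' \<and>
     (\<forall>\<xi>\<in>{0, 1}. W \<xi> = 0 \<and> W' \<xi> = 0)}"

text \<open>The dimension is that of the space of classes, so spanning is required only almost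
  everywhere.\<close>

definition fin_dim_subspace :: "(real \<Rightarrow> real) set \<Rightarrow> bool" where
  "fin_dim_subspace S \<longleftrightarrow>
     (\<lambda>x. 0) \<in> S \<and>
     (\<forall>f\<in>S. \<forall>g\<in>S. (\<lambda>x. f x + g x) \<in> S) \<and>
     (\<forall>c. \<forall>f\<in>S. (\<lambda>x. c * f x) \<in> S) \<and>
     (\<exists>B. finite B \<and> B \<subseteq> S \<and>
       (\<forall>f\<in>S. \<exists>c. AE x in lebesgue_on Omega. f x = (\<Sum>b\<in>B. c b * b x)))"

fun bform :: "real \<Rightarrow> real \<Rightarrow> (real \<Rightarrow> real) \<times> (real \<Rightarrow> real) \<Rightarrow> (real \<Rightarrow> real) \<times> (real \<Rightarrow> real) \<Rightarrow> real"
  where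
  "bform lam \<epsilon> (u, v) (us, vs) =
     lam * l2_inner (\<lambda>x. v x - \<epsilon> powr (3/2) * wderiv 2 u x)
                    (\<lambda>x. vs x - \<epsilon> powr (3/2) * wderiv 2 us x)
     + l2_inner (\<lambda>x. \<epsilon> powr (5/2) * wderiv 2 v x + 4 * u x)
                (\<lambda>x. \<epsilon> powr (3/2) * wderiv 2 vs x + 4 * us x)"

fun fform :: "real \<Rightarrow> (real \<Rightarrow> real) \<Rightarrow> (real \<Rightarrow> real) \<times> (real \<Rightarrow> real) \<Rightarrow> real" where
  "fform \<epsilon> f (us, vs) = l2_inner f (\<lambda>x. \<epsilon> powr (3/2) * wderiv 2 vs x + 4 * us x)"

fun bal_norm :: "real \<Rightarrow> (real \<Rightarrow> real) \<times> (real \<Rightarrow> real) \<Rightarrow> real" where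
  "bal_norm \<epsilon> (u, v) = sqrt ((l2_norm u)\<^sup>2 + \<epsilon> ^ 3 * (l2_norm (wderiv 2 u))\<^sup>2
                            + (l2_norm v)\<^sup>2 + \<epsilon> ^ 4 * (l2_norm (wderiv 2 v))\<^sup>2)"

definition bvp_solution :: "real \<Rightarrow> (real \<Rightarrow> real) \<Rightarrow> (real \<Rightarrow> real) \<Rightarrow> bool" where
  "bvp_solution \<epsilon> f u \<longleftrightarrow> u \<in> sobolev 4 \<and> u \<in> H02 \<and>
     (AE x in lebesgue_on Omega. \<epsilon> ^ 4 * wderiv 4 u x + 4 * u x = f x)"

end

theory Submission
  imports Defs
begin

text \<open>The estimate is Cea's lemma for the balanced norm. Put \<open>k = \<epsilon> powr (3/2)\<close>, so that
  \<open>\<epsilon> powr (5/2) = \<epsilon> * k\<close> and \<open>k\<^sup>2 = \<epsilon> ^ 3\<close>. For the exact solution the pair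
  \<open>(u, k * u'')\<close> makes the first residual \<open>v - k * u''\<close> vanish and turns the second one into
  \<open>\<epsilon> ^ 4 * u'''' + 4 * u = f\<close>, so it satisfies the discrete equations as well
  (\<open>bform_consistent\<close>) and the error is orthogonal to the discrete space.

  Everything then depends on the identity \<open>\<langle>p, q''\<rangle> = \<langle>p'', q\<rangle>\<close> for \<open>p \<in> H02\<close> and
  \<open>q \<in> sobolev 2\<close> (\<open>H02_integral_by_parts\<close>). The term \<open>4 * k * \<langle>p, q''\<rangle>\<close> of the bilinear form
  cannot be bounded uniformly in \<open>\<epsilon>\<close> as it stands, because the balanced norm only controls
  \<open>\<epsilon>\<^sup>2 * \<parallel>q''\<parallel>\<close> and \<open>k / \<epsilon>\<^sup>2\<close> is unbounded as \<open>\<epsilon>\<close> tends to 0; written as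
  \<open>4 * k * \<langle>p'', q\<rangle>\<close> it is bounded by
  \<open>4 * (k * \<parallel>p''\<parallel>) * \<parallel>q\<parallel>\<close> (\<open>bform_bounded\<close>). In the quadratic form the two mixed terms of the
  second product become \<open>4 * (1 + \<epsilon>) * k * \<langle>p'', q\<rangle>\<close>, and for \<open>lam \<ge> 3\<close> this indefinite
  contribution is absorbed by \<open>lam * \<parallel>q - k * p''\<parallel>\<^sup>2\<close>; the form is coercive with constant 1
  (\<open>bform_coercive\<close>). Coercivity, orthogonality and boundedness give the estimate with the
  constant \<open>4 * lam + 25\<close> (\<open>quasi_optimality\<close>). For the second inequality, \<open>v\<^sub>*\<close> is replaced by
  \<open>k * v\<^sub>*\<close>, which ranges over the same space.

  The integration by parts has to be derived from the definition of weak derivatives by test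
  functions. Explicit bump functions converge to indicators of intervals, which yields the
  fundamental lemma of the calculus of variations (\<open>fundamental_lemma\<close>) and hence uniqueness of
  weak derivatives. By the du Bois-Reymond argument a function with a weak derivative \<open>r\<close> is a
  constant plus the primitive of \<open>r\<close> (\<open>weak_deriv_imp_primitive\<close>), and for primitives integration by
  parts is Fubini's theorem (\<open>primitive_integral_by_parts\<close>).\<close>

section \<open>Smooth functions\<close>

definition smooth :: "(real \<Rightarrow> real) \<Rightarrow> bool" where
  "smooth f \<longleftrightarrow> (\<forall>n x. ((deriv ^^ n) f) differentiable (at x))"

lemma DERIV_differentiable: "(f has_real_derivative D) (at x) \<Longrightarrow> f differentiable (at x)"
  unfolding real_differentiable_def by blast

text \<open>Smoothness of an explicit function is shown without computing iterated derivatives, by a class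
  of everywhere differentiable functions that is closed under \<open>deriv\<close>.\<close>
lemma smooth_coinduct:
  assumes "f \<in> S" and "\<And>g x. g \<in> S \<Longrightarrow> g differentiable (at x)" and "\<And>g. g \<in> S \<Longrightarrow> deriv g \<in> S"
  shows "smooth f"
proof -
  have "(deriv ^^ n) f \<in> S" for n
    by (induction n) (auto simp: assms)
  then show ?thesis
    using assms(2) by (auto simp: smooth_def)
qed

lemma smooth_differentiable: "smooth f \<Longrightarrow> f differentiable (at x)"
  unfolding smooth_def by (metis funpow_0)

lemma smooth_DERIV: "smooth f \<Longrightarrow> (f has_real_derivative deriv f x) (at x)"
  using smooth_differentiable DERIV_deriv_iff_real_differentiable by blast

lemma smooth_deriv: "smooth f \<Longrightarrow> smooth (deriv f)"
  unfolding smooth_def by (metis funpow_Suc_right o_apply)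

lemma smooth_antideriv:
  assumes "\<And>x. (F has_real_derivative f x) (at x)" "smooth f"
  shows "smooth F"
proof -
  have "deriv F = f" using assms(1) by (auto intro: DERIV_imp_deriv)
  then have "((deriv ^^ n) F) differentiable (at x)" for n x
    using assms by (cases n) (auto simp: smooth_def funpow_Suc_right simp del: funpow.simps intro: DERIV_differentiable)
  then show ?thesis by (simp add: smooth_def)
qed

text \<open>The product rule turns a product into a sum of products, so that closure under \<open>deriv\<close> is
  visible only for the algebra generated by the smooth functions.\<close>
inductive_set smooth_alg :: "(real \<Rightarrow> real) set" where
  base: "smooth f \<Longrightarrow> f \<in> smooth_alg"
| add: "f \<in> smooth_alg \<Longrightarrow> g \<in> smooth_alg \<Longrightarrow> (\<lambda>x. f x + g x) \<in> smooth_alg"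
| mult: "f \<in> smooth_alg \<Longrightarrow> g \<in> smooth_alg \<Longrightarrow> (\<lambda>x. f x * g x) \<in> smooth_alg"

lemma smooth_alg_deriv:
  "f \<in> smooth_alg \<Longrightarrow> (\<forall>x. f differentiable (at x)) \<and> deriv f \<in> smooth_alg"
proof (induction rule: smooth_alg.induct)
  case (base f)
  then show ?case by (auto intro: smooth_alg.base smooth_deriv smooth_differentiable)
next
  case (add f g)
  then have "deriv (\<lambda>x. f x + g x) = (\<lambda>x. deriv f x + deriv g x)"
    by (intro ext DERIV_imp_deriv DERIV_add) (auto simp: DERIV_deriv_iff_real_differentiable)
  moreover have "(\<lambda>x. deriv f x + deriv g x) \<in> smooth_alg"
    using add by (blast intro: smooth_alg.add)
  moreover have "(\<lambda>x. f x + g x) differentiable (at x)" for x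
    using add by (blast intro: differentiable_add)
  ultimately show ?case by simp
next
  case (mult f g)
  then have "deriv (\<lambda>x. f x * g x) = (\<lambda>x. deriv f x * g x + deriv g x * f x)"
    by (intro ext DERIV_imp_deriv DERIV_mult) (auto simp: DERIV_deriv_iff_real_differentiable)
  moreover have "(\<lambda>x. deriv f x * g x + deriv g x * f x) \<in> smooth_alg"
    using mult by (intro smooth_alg.add smooth_alg.mult) auto
  moreover have "(\<lambda>x. f x * g x) differentiable (at x)" for x
    using mult by (blast intro: differentiable_mult)
  ultimately show ?case by simp
qed

lemma smooth_alg_smooth: "f \<in> smooth_alg \<Longrightarrow> smooth f"
  by (rule smooth_coinduct[of f smooth_alg]) (auto dest: smooth_alg_deriv)

lemma smooth_add: "smooth f \<Longrightarrow> smooth g \<Longrightarrow> smooth (\<lambda>x. f x + g x)"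
  by (rule smooth_alg_smooth, rule smooth_alg.add) (auto intro: smooth_alg.base)

lemma smooth_mult: "smooth f \<Longrightarrow> smooth g \<Longrightarrow> smooth (\<lambda>x. f x * g x)"
  by (rule smooth_alg_smooth, rule smooth_alg.mult) (auto intro: smooth_alg.base)

lemma smooth_const: "smooth (\<lambda>x. c)"
proof (rule smooth_coinduct[of _ "{g. \<exists>c. g = (\<lambda>x. c)}"])
  fix g :: "real \<Rightarrow> real" assume "g \<in> {g. \<exists>c. g = (\<lambda>x. c)}"
  then obtain c where g: "g = (\<lambda>x. c)" by blast
  show "g differentiable (at x)" for x
    by (simp add: g)
  have "deriv g = (\<lambda>x. 0)"
    unfolding g by (rule ext) simp
  then show "deriv g \<in> {g. \<exists>c. g = (\<lambda>x. c)}"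
    by blast
qed blast

lemma smooth_affine:
  assumes "smooth f"
  shows "smooth (\<lambda>x. f (a * x + b))"
proof (rule smooth_coinduct[of _ "{\<lambda>x. c * g (a * x + b) | c g. smooth g}"])
  show "(\<lambda>x. f (a * x + b)) \<in> {\<lambda>x. c * g (a * x + b) |c g. smooth g}"
    using assms by (auto intro!: exI[of _ 1] exI[of _ f])
next
  fix h :: "real \<Rightarrow> real" assume "h \<in> {\<lambda>x. c * g (a * x + b) | c g. smooth g}"
  then obtain c g where h: "h = (\<lambda>x. c * g (a * x + b))" and g: "smooth g" by auto
  have D: "(h has_real_derivative (c * a) * deriv g (a * x + b)) (at x)" for x
  proof -
    have "((\<lambda>x. a * x + b) has_real_derivative a) (at x)"
      by (auto intro!: derivative_eq_intros)
    from DERIV_cmult[OF DERIV_chain2[OF smooth_DERIV[OF g] this], of c] show ?thesis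
      by (simp add: h ac_simps)
  qed
  show "h differentiable (at x)" for x
    using D by (auto intro: DERIV_differentiable)
  have "deriv h = (\<lambda>x. (c * a) * deriv g (a * x + b))"
    using D by (auto intro: DERIV_imp_deriv)
  then show "deriv h \<in> {\<lambda>x. c * g (a * x + b) |c g. smooth g}"
    using g smooth_deriv by blast
qed

text \<open>\<open>flat 1\<close> is the standard smooth function \<open>exp (- 1 / x)\<close> that vanishes to infinite order at
  0. The polynomial factors in \<open>1 / x\<close> make the family closed under differentiation.\<close>
definition flat :: "real poly \<Rightarrow> real \<Rightarrow> real" where
  "flat p x = (if x > 0 then poly p (1/x) * exp (-1/x) else 0)"

lemma poly_exp_decay: "((\<lambda>t. poly p t * exp (-t)) \<longlongrightarrow> (0::real)) at_top"
proof -
  have "((\<lambda>t. \<Sum>i\<le>degree p. coeff p i * (t ^ i / exp t)) \<longlongrightarrow> (\<Sum>i\<le>degree p. coeff p i * 0)) at_top"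
    by (intro tendsto_sum tendsto_mult tendsto_const tendsto_power_div_exp_0)
  moreover have "poly p t * exp (-t) = (\<Sum>i\<le>degree p. coeff p i * (t ^ i / exp t))" for t
    by (simp add: poly_altdef exp_minus divide_inverse sum_distrib_right mult.assoc)
  ultimately show ?thesis
    by simp
qed

text \<open>Away from 0 this is the chain rule. At 0 the difference quotient from the right is
  \<open>t * p t * exp (- t)\<close> with \<open>t = 1 / h\<close>, and the exponential wins.\<close>
lemma flat_DERIV: "(flat p has_real_derivative flat ([:0,0,1:] * (p - pderiv p)) x) (at x)"
proof (cases x "0::real" rule: linorder_cases)
  case greater
  have "((\<lambda>x. poly p (1/x) * exp (-1/x)) has_real_derivative flat ([:0,0,1:] * (p - pderiv p)) x) (at x)"
  proof -
    have 1: "((\<lambda>x. 1/x) has_real_derivative - (1 / x^2)) (at x)"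
      using greater by (auto intro!: derivative_eq_intros simp: power2_eq_square)
    have 2: "((\<lambda>x. exp (-1/x)) has_real_derivative exp (-1/x) * (1 / x^2)) (at x)"
      using greater by (auto intro!: derivative_eq_intros simp: power2_eq_square)
    show ?thesis
      using DERIV_mult[OF DERIV_chain2[OF poly_DERIV 1, of p] 2] greater
      by (simp add: flat_def field_simps power2_eq_square)
  qed
  then show ?thesis
    by (rule has_field_derivative_transform_within[where d=x]) (use greater in \<open>auto simp: flat_def dist_real_def\<close>)
next
  case less
  have "((\<lambda>x. 0) has_real_derivative 0) (at x)" by simp
  then have "(flat p has_real_derivative 0) (at x)"
    by (rule has_field_derivative_transform_within[where d="-x"]) (use less in \<open>auto simp: flat_def dist_real_def\<close>)
  with less show ?thesis by (simp add: flat_def)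
next
  case equal
  have "((\<lambda>h. flat p h / h) \<longlongrightarrow> 0) (at_right 0)"
  proof -
    have "((\<lambda>h. poly (pCons 0 p) (inverse h) * exp (- inverse h)) \<longlongrightarrow> 0) (at_right (0::real))"
      by (rule filterlim_compose[OF poly_exp_decay filterlim_inverse_at_top_right])
    then show ?thesis
      by (rule Lim_transform_eventually)
        (auto simp: eventually_at_filter flat_def field_simps)
  qed
  moreover have "((\<lambda>h. flat p h / h) \<longlongrightarrow> 0) (at_left 0)"
    by (rule Lim_transform_eventually[of "\<lambda>_. 0"]) (auto simp: eventually_at_filter flat_def)
  ultimately have "((\<lambda>h. flat p h / h) \<longlongrightarrow> 0) (at 0)"
    by (simp add: filterlim_at_split)
  with equal show ?thesis
    by (simp add: DERIV_def flat_def)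
qed

lemma smooth_flat: "smooth (flat p)"
proof (rule smooth_coinduct[of _ "range flat"])
  show "g differentiable (at x)" if "g \<in> range flat" for g x
    using that flat_DERIV by (auto intro: DERIV_differentiable)
  have "deriv (flat p) = flat ([:0,0,1:] * (p - pderiv p))" for p
    using flat_DERIV by (auto intro: DERIV_imp_deriv)
  then show "deriv g \<in> range flat" if "g \<in> range flat" for g
    using that by auto
qed auto

section \<open>Test functions\<close>

abbreviation M :: "real measure" where "M \<equiv> lebesgue_on Omega"

lemma test_fun_smooth: "test_fun \<phi> \<Longrightarrow> smooth \<phi>"
  by (simp add: test_fun_def smooth_def)

lemma test_funI:
  assumes "smooth \<phi>" "0 < a" "b < 1" "\<And>x. \<phi> x \<noteq> 0 \<Longrightarrow> a \<le> x \<and> x \<le> b"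
  shows "test_fun \<phi>"
proof -
  have "closure {x. \<phi> x \<noteq> 0} \<subseteq> {a..b}"
    using assms(4) by (intro closure_minimal) auto
  moreover from this have "compact (closure {x. \<phi> x \<noteq> 0})"
    by (meson bounded_closed_interval bounded_subset closed_closure compact_eq_bounded_closed)
  ultimately show ?thesis
    using assms by (auto simp: test_fun_def smooth_def)
qed

text \<open>The support is compact and \<open>Omega\<close> is open, so the support stays away from both end points.\<close>
lemma test_fun_support:
  assumes "test_fun \<phi>"
  obtains a b where "0 < a" "a < b" "b < 1" "\<And>x. \<phi> x \<noteq> 0 \<Longrightarrow> a < x \<and> x < b"
proof -
  let ?K = "closure {x. \<phi> x \<noteq> 0}"
  have K: "compact ?K" "?K \<subseteq> Omega"
    using assms by (auto simp: test_fun_def)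
  have sub: "x \<in> ?K" if "\<phi> x \<noteq> 0" for x
    using that closure_subset[of "{x. \<phi> x \<noteq> 0}"] by auto
  show thesis
  proof (cases "?K = {}")
    case True
    then show thesis
      using sub by (intro that[of "1/3" "2/3"]) auto
  next
    case False
    obtain l where l: "l \<in> ?K" "\<And>x. x \<in> ?K \<Longrightarrow> l \<le> x"
      using compact_attains_inf[OF K(1) False] by blast
    obtain u where u: "u \<in> ?K" "\<And>x. x \<in> ?K \<Longrightarrow> x \<le> u"
      using compact_attains_sup[OF K(1) False] by blast
    show thesis
    proof (rule that[of "l/2" "(u+1)/2"])
      show "0 < l/2" "(u+1)/2 < 1"
        using l(1) u(1) K(2) by auto
      show "l/2 < (u+1)/2"
        using l(2)[OF u(1)] by simp
      show "l/2 < x \<and> x < (u+1)/2" if "\<phi> x \<noteq> 0" for x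
        using l(2)[OF sub[OF that]] u(2)[OF sub[OF that]] subsetD[OF K(2) l(1)] subsetD[OF K(2) u(1)]
        by simp
    qed
  qed
qed

lemma test_fun_deriv:
  assumes "test_fun \<phi>"
  shows "test_fun (deriv \<phi>)"
proof -
  obtain a b where ab: "0 < a" "a < b" "b < 1" "\<And>x. \<phi> x \<noteq> 0 \<Longrightarrow> a < x \<and> x < b"
    using test_fun_support[OF assms] by metis
  show ?thesis
  proof (rule test_funI[OF smooth_deriv[OF test_fun_smooth[OF assms]] ab(1,3)], rule ccontr)
    fix x assume x: "deriv \<phi> x \<noteq> 0" "\<not> (a \<le> x \<and> x \<le> b)"
    have "((\<lambda>_. 0) has_real_derivative 0) (at x)"
      by simp
    then have "(\<phi> has_real_derivative 0) (at x)"
    proof (rule has_field_derivative_transform_within_open[where S = "- {a..b}"])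
      show "0 = \<phi> y" if "y \<in> - {a..b}" for y
        using ab(4)[of y] that by force
    qed (use x in auto)
    then show False
      using x DERIV_imp_deriv by blast
  qed
qed

lemma test_fun_derivs: "test_fun \<phi> \<Longrightarrow> test_fun ((deriv ^^ n) \<phi>)"
  by (induction n) (simp_all add: test_fun_deriv)

lemma test_fun_cmult:
  assumes "test_fun \<phi>"
  shows "test_fun (\<lambda>x. c * \<phi> x)"
proof -
  obtain a b where ab: "0 < a" "a < b" "b < 1" "\<And>x. \<phi> x \<noteq> 0 \<Longrightarrow> a < x \<and> x < b"
    using test_fun_support[OF assms] by metis
  show ?thesis
  proof (rule test_funI[OF smooth_mult[OF smooth_const test_fun_smooth[OF assms]] ab(1,3)])
    show "a \<le> x \<and> x \<le> b" if "c * \<phi> x \<noteq> 0" for x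
      using ab(4)[of x] that by simp
  qed
qed

lemma test_fun_add:
  assumes "test_fun \<phi>" "test_fun \<psi>"
  shows "test_fun (\<lambda>x. \<phi> x + \<psi> x)"
proof -
  obtain a b where ab: "0 < a" "a < b" "b < 1" "\<And>x. \<phi> x \<noteq> 0 \<Longrightarrow> a < x \<and> x < b"
    using test_fun_support[OF assms(1)] by metis
  obtain c d where cd: "0 < c" "c < d" "d < 1" "\<And>x. \<psi> x \<noteq> 0 \<Longrightarrow> c < x \<and> x < d"
    using test_fun_support[OF assms(2)] by metis
  show ?thesis
  proof (rule test_funI[OF smooth_add, of _ _ "min a c" "max b d"])
    fix x assume "\<phi> x + \<psi> x \<noteq> 0"
    then have "\<phi> x \<noteq> 0 \<or> \<psi> x \<noteq> 0" by auto
    then show "min a c \<le> x \<and> x \<le> max b d"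
      using ab(4)[of x] cd(4)[of x] by auto
  qed (use assms ab cd in \<open>auto intro: test_fun_smooth\<close>)
qed

lemma smooth_continuous: "smooth f \<Longrightarrow> continuous_on S f"
  by (meson continuous_at_imp_continuous_on DERIV_isCont smooth_DERIV)

lemma test_fun_continuous: "test_fun \<phi> \<Longrightarrow> continuous_on S \<phi>"
  by (rule smooth_continuous[OF test_fun_smooth])

text \<open>A smooth approximation of the indicator of \<open>{0<..<b}\<close>: each factor tends to 1 where its
  argument grows with \<open>n\<close>. The shifts by 1 keep the support inside \<open>{1/n..b - 1/n}\<close>, so that it
  is compact in \<open>Omega\<close> even for \<open>b = 1\<close>.\<close>
definition bump :: "nat \<Rightarrow> real \<Rightarrow> real \<Rightarrow> real" where
  "bump n b x = flat 1 (real n * x - 1) * flat 1 (real n * (b - x) - 1)"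

lemma bump_range: "0 \<le> bump n b x" "bump n b x \<le> 1"
  by (auto simp: bump_def flat_def intro!: mult_nonneg_nonneg mult_le_one)

lemma bump_smooth: "smooth (bump n b)"
proof -
  have "smooth (\<lambda>x. flat 1 (real n * x + (-1)) * flat 1 ((- real n) * x + (real n * b - 1)))"
    by (intro smooth_mult smooth_affine smooth_flat)
  also have "(\<lambda>x. flat 1 (real n * x + (-1)) * flat 1 ((- real n) * x + (real n * b - 1))) = bump n b"
    by (simp add: bump_def fun_eq_iff algebra_simps)
  finally show ?thesis .
qed

lemma bump_test_fun:
  assumes "b \<le> 1" "0 < n"
  shows "test_fun (bump n b)"
proof (rule test_funI[of _ "1 / n" "b - 1 / n"])
  show "smooth (bump n b)"
    by (rule bump_smooth)
  show "1 / n \<le> x \<and> x \<le> b - 1 / n" if "bump n b x \<noteq> 0" for x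
    using that assms by (auto simp: bump_def flat_def field_simps split: if_splits)
  have "0 < 1 / real n"
    using assms by simp
  then show "0 < 1 / real n" "b - 1 / real n < 1"
    using assms by linarith+
qed

lemma flat_1_tendsto: "(flat 1 \<longlongrightarrow> 1) at_top"
proof -
  have "((\<lambda>x::real. exp (- (1/x))) \<longlongrightarrow> exp (- 0)) at_top"
    by (intro tendsto_intros tendsto_divide_0[OF tendsto_const] filterlim_at_top_imp_at_infinity filterlim_ident)
  then have "((\<lambda>x::real. exp (- (1/x))) \<longlongrightarrow> 1) at_top"
    by simp
  then show ?thesis
    by (rule Lim_transform_eventually)
      (auto simp: flat_def intro!: eventually_mono[OF eventually_gt_at_top[of 0]])
qed

lemma bump_tendsto: "(\<lambda>n. bump n b x) \<longlonglongrightarrow> indicator {0<..<b} x"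
proof (cases "x \<in> {0<..<b}")
  case True
  have lim: "(\<lambda>n. flat 1 (real n * y - 1)) \<longlonglongrightarrow> 1" if "y > 0" for y
  proof (rule filterlim_compose[OF flat_1_tendsto])
    show "filterlim (\<lambda>n. real n * y - 1) at_top sequentially"
      using filterlim_tendsto_add_at_top[OF tendsto_const[of "-1"]
          filterlim_at_top_mult_tendsto_pos[OF tendsto_const that filterlim_real_sequentially]]
      by simp
  qed
  have "(\<lambda>n. bump n b x) \<longlonglongrightarrow> 1 * 1"
    unfolding bump_def using True by (intro tendsto_mult lim) auto
  with True show ?thesis by simp
next
  case False
  then have "bump n b x = 0" for n
    using mult_nonneg_nonpos[of "real n" x] mult_nonneg_nonpos[of "real n" "b - x"]
    by (auto simp: bump_def flat_def)
  with False show ?thesis by simp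
qed

section \<open>The fundamental lemma of the calculus of variations\<close>

lemma finite_measure_M: "finite_measure M"
  using finite_measure_lebesgue_on[OF lmeasurable_box[of 0 "1::real"]] by simp

lemma borel_measurable_M:
  "f \<in> borel_measurable borel \<Longrightarrow> f \<in> borel_measurable M"
  by (intro measurable_restrict_space1 measurable_completion) simp

lemma AE_M_lborel: "AE x in lborel. x \<in> Omega \<longrightarrow> P x \<Longrightarrow> AE x in M. P x"
  by (simp add: AE_restrict_space_iff AE_completion)

lemma AE_M_neq: "AE x in M. x \<noteq> c"
  by (rule AE_M_lborel) (use AE_lborel_singleton[of c] in eventually_elim, simp)

lemma integrable_M_mult_bounded:
  fixes f g :: "real \<Rightarrow> real"
  assumes "integrable M f" "g \<in> borel_measurable M" "\<And>x. x \<in> Omega \<Longrightarrow> \<bar>g x\<bar> \<le> B"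
  shows "integrable M (\<lambda>x. f x * g x)"
proof (rule Bochner_Integration.integrable_bound)
  show "integrable M (\<lambda>x. B * f x)"
    using assms by simp
  show "AE x in M. norm (f x * g x) \<le> norm (B * f x)"
  proof (rule AE_I2)
    fix x assume "x \<in> space M"
    then have "\<bar>g x\<bar> \<le> \<bar>B\<bar>"
      using assms(3)[of x] by simp
    then show "norm (f x * g x) \<le> norm (B * f x)"
      by (simp add: abs_mult mult.commute[of "\<bar>f x\<bar>"] mult_right_mono)
  qed
  show "(\<lambda>x. f x * g x) \<in> borel_measurable M"
    using assms by (intro borel_measurable_times) auto
qed

lemma bump_integral_tendsto:
  assumes "integrable M h"
  shows "(\<lambda>n. \<integral>x. h x * bump (Suc n) b x \<partial>M) \<longlonglongrightarrow> (\<integral>x. h x * indicator {0<..<b} x \<partial>M)"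
proof (rule integral_dominated_convergence)
  have "bump n b \<in> borel_measurable borel" for n
    by (intro borel_measurable_continuous_onI smooth_continuous bump_smooth)
  then show "(\<lambda>x. h x * bump (Suc n) b x) \<in> borel_measurable M" for n
    using assms by (intro borel_measurable_times borel_measurable_M[of "bump _ _"]) auto
  show "(\<lambda>x. h x * indicator {0<..<b} x) \<in> borel_measurable M"
    using assms by (intro borel_measurable_times borel_measurable_M[of "indicator _"]) auto
  show "integrable M (\<lambda>x. \<bar>h x\<bar>)"
    using assms by simp
  show "AE x in M. (\<lambda>n. h x * bump (Suc n) b x) \<longlonglongrightarrow> h x * indicator {0<..<b} x"
    by (intro AE_I2 tendsto_mult tendsto_const LIMSEQ_Suc bump_tendsto)
  show "AE x in M. norm (h x * bump (Suc n) b x) \<le> \<bar>h x\<bar>" for n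
    using bump_range by (intro AE_I2) (simp add: abs_mult mult_left_le)
qed

text \<open>The sets on which the integral of \<open>H\<close> vanishes form a Dynkin system, and the half-lines are an
  intersection-stable generator of the Borel sets.\<close>
lemma AE_zero_if_initial_integrals_zero:
  fixes H :: "real \<Rightarrow> real"
  assumes H: "integrable lborel H" and zero: "\<And>b. (LINT x:{..<b}|lborel. H x) = 0"
    and total: "(\<integral>x. H x \<partial>lborel) = 0"
  shows "AE x in lborel. H x = 0"
proof (rule sigma_finite_measure.density_zero[OF sigma_finite_lborel H])
  have int: "set_integrable lborel A H" if "A \<in> sets borel" for A
    using that H unfolding set_integrable_def by (intro integrable_mult_indicator) auto
  have sets: "sets borel = sigma_sets UNIV (range (lessThan :: real \<Rightarrow> _))"
    by (subst borel_Iio) simp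
  have stable: "Int_stable (range (lessThan :: real \<Rightarrow> _))"
  proof -
    have "{..<a} \<inter> {..<b} = {..<min a b}" for a b :: real
      by auto
    then show ?thesis by (auto simp: Int_stable_def)
  qed
  have Pow: "range (lessThan :: real \<Rightarrow> _) \<subseteq> Pow UNIV"
    by simp
  fix A :: "real set" assume "A \<in> sets lborel"
  then have "A \<in> sigma_sets UNIV (range (lessThan :: real \<Rightarrow> _))"
    using sets by simp
  then show "(LINT x:A|lborel. H x) = 0"
  proof (induction rule: sigma_sets_induct_disjoint[OF stable Pow, consumes 1, case_names basic empty compl union])
    case (basic A) then show ?case using zero by auto
  next
    case empty then show ?case by (simp add: set_lebesgue_integral_def)
  next
    case (compl A)
    then have A: "A \<in> sets borel" using sets by simp
    have "(LINT x:UNIV|lborel. H x) = (LINT x:A|lborel. H x) + (LINT x:UNIV - A|lborel. H x)"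
      using set_integral_Un[of A "UNIV - A" lborel H] int[of A] int[of "UNIV - A"] A by simp
    then show ?case
      using compl total by (simp add: set_lebesgue_integral_def)
  next
    case (union A)
    then have A: "A i \<in> sets borel" for i using sets by auto
    have "(LINT x:(\<Union>i. A i)|lborel. H x) = (\<Sum>i. (LINT x:(A i)|lborel. H x))"
      using union(1) A by (intro lebesgue_integral_countable_add int) (auto simp: disjoint_family_on_def)
    then show ?case using union by simp
  qed
qed

text \<open>Testing with the bump functions and passing to the limit by dominated convergence shows that the
  integrals over all \<open>{0<..<b}\<close> vanish, which determines an integrable function up to null sets.\<close>
lemma fundamental_lemma:
  assumes h: "integrable M h" and orth: "\<And>\<phi>. test_fun \<phi> \<Longrightarrow> (\<integral>x. h x * \<phi> x \<partial>M) = 0"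
  shows "AE x in M. h x = 0"
proof -
  let ?H = "\<lambda>x. indicator Omega x * h x"
  have H: "integrable lebesgue ?H"
    using h by (simp add: integrable_restrict_space)
  (* Dynkin arguments need Borel sets, so h is replaced by a Borel measurable representative. *)
  then obtain H' where H': "H' \<in> borel_measurable lborel" and ae: "AE x in lborel. ?H x = H' x"
    using completion_ex_borel_measurable_real[of ?H lborel] by auto
  have ae': "AE x in lebesgue. ?H x = H' x"
    using ae by (rule AE_completion)
  have intH': "integrable lborel H'"
  proof -
    have "integrable lebesgue H'"
      using H' measurable_completion[OF H'] by (intro integrable_cong_AE_imp[OF H _ ae']) 
    then show ?thesis
      using integrable_completion[OF H'] by simp
  qed
  have zero1: "(\<integral>x. h x * indicator {0<..<b} x \<partial>M) = 0" if "b \<le> 1" for b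
  proof -
    have "(\<lambda>n. \<integral>x. h x * bump (Suc n) b x \<partial>M) = (\<lambda>n. 0)"
      using that by (intro ext orth bump_test_fun) auto
    then show ?thesis
      using bump_integral_tendsto[OF h, of b] by (simp add: LIMSEQ_const_iff)
  qed
  have zero: "(LINT x:A|lborel. H' x) = (\<integral>x. h x * indicator A x \<partial>M)" if A: "A \<in> sets borel" for A
  proof -
    have "(LINT x:A|lborel. H' x) = (\<integral>x. indicator A x * H' x \<partial>lebesgue)"
      using A H' by (simp add: set_lebesgue_integral_def integral_completion)
    also have "\<dots> = (\<integral>x. indicator A x * ?H x \<partial>lebesgue)"
    proof (rule integral_cong_AE)
      show "(\<lambda>x. indicator A x * H' x) \<in> borel_measurable lebesgue"
        using A H' by (intro measurable_completion) auto
      show "(\<lambda>x. indicator A x * ?H x) \<in> borel_measurable lebesgue"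
        using A borel_measurable_integrable[OF H] 
        by (rule_tac borel_measurable_times) (auto intro: measurable_completion)
      show "AE x in lebesgue. indicator A x * H' x = indicator A x * ?H x"
        using ae' by eventually_elim simp
    qed
    also have "\<dots> = (\<integral>x. h x * indicator A x \<partial>M)"
      by (simp add: integral_restrict_space ac_simps)
    finally show ?thesis .
  qed
  have "AE x in lborel. H' x = 0"
  proof (rule AE_zero_if_initial_integrals_zero[OF intH'])
    fix b :: real
    have "(LINT x:{..<b}|lborel. H' x) = (\<integral>x. h x * indicator {..<b} x \<partial>M)"
      by (rule zero) simp
    also have "\<dots> = (\<integral>x. h x * indicator {0<..<min b 1} x \<partial>M)"
      by (intro Bochner_Integration.integral_cong) (auto simp: indicator_def)
    finally show "(LINT x:{..<b}|lborel. H' x) = 0"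
      using zero1 by simp
  next
    have "(\<integral>x. H' x \<partial>lborel) = (LINT x:UNIV|lborel. H' x)"
      by (simp add: set_lebesgue_integral_def)
    also have "\<dots> = (\<integral>x. h x * indicator {0<..<1} x \<partial>M)"
      by (subst zero, simp) (intro Bochner_Integration.integral_cong, auto simp: indicator_def)
    finally show "(\<integral>x. H' x \<partial>lborel) = 0"
      using zero1 by simp
  qed
  with ae have "AE x in lborel. x \<in> Omega \<longrightarrow> h x = 0"
    by eventually_elim (auto simp: indicator_def)
  then show ?thesis
    by (rule AE_M_lborel)
qed

section \<open>Square integrable functions\<close>

interpretation M: finite_measure M
  by (rule finite_measure_M)

lemma L2_measurable: "f \<in> L2 \<Longrightarrow> f \<in> borel_measurable M"
  by (simp add: L2_def)

lemma L2_mult_integrable: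
  assumes "f \<in> L2" "g \<in> L2"
  shows "integrable M (\<lambda>x. f x * g x)"
proof (rule Bochner_Integration.integrable_bound)
  show "integrable M (\<lambda>x. (f x)\<^sup>2 + (g x)\<^sup>2)"
    using assms by (simp add: L2_def)
  show "AE x in M. norm (f x * g x) \<le> norm ((f x)\<^sup>2 + (g x)\<^sup>2)"
  proof (rule AE_I2)
    fix x
    have "0 \<le> (\<bar>f x\<bar> - \<bar>g x\<bar>)\<^sup>2 + (f x)\<^sup>2 + (g x)\<^sup>2" by simp
    then show "norm (f x * g x) \<le> norm ((f x)\<^sup>2 + (g x)\<^sup>2)"
      by (simp add: abs_mult power2_diff)
  qed
qed (use assms[THEN L2_measurable] in simp)

lemma L2_bounded:
  assumes "f \<in> borel_measurable M" "\<And>x. x \<in> Omega \<Longrightarrow> \<bar>f x\<bar> \<le> B"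
  shows "f \<in> L2"
proof -
  have "integrable M (\<lambda>x. (1 * f x) * f x)"
    by (rule integrable_M_mult_bounded[OF integrable_M_mult_bounded]) (use assms in auto)
  then show ?thesis
    using assms by (simp add: L2_def power2_eq_square)
qed

lemma L2_const: "(\<lambda>x. c) \<in> L2"
  by (rule L2_bounded[of _ "\<bar>c\<bar>"]) auto

lemma L2_integrable: "f \<in> L2 \<Longrightarrow> integrable M f"
  using L2_mult_integrable[OF _ L2_const[of 1]] by simp

lemma L2_cmult: "f \<in> L2 \<Longrightarrow> (\<lambda>x. c * f x) \<in> L2"
  by (auto simp: L2_def power_mult_distrib)

lemma L2_add:
  assumes "f \<in> L2" "g \<in> L2"
  shows "(\<lambda>x. f x + g x) \<in> L2"
proof -
  have "integrable M (\<lambda>x. (f x)\<^sup>2 + 2 * (f x * g x) + (g x)\<^sup>2)"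
    using assms L2_mult_integrable[OF assms] by (auto simp: L2_def)
  moreover have "(\<lambda>x. (f x + g x)\<^sup>2) = (\<lambda>x. (f x)\<^sup>2 + 2 * (f x * g x) + (g x)\<^sup>2)"
    by (auto simp: power2_sum)
  ultimately show ?thesis
    using assms[THEN L2_measurable] by (simp add: L2_def)
qed

lemma L2_diff: "f \<in> L2 \<Longrightarrow> g \<in> L2 \<Longrightarrow> (\<lambda>x. f x - g x) \<in> L2"
  using L2_add[OF _ L2_cmult[of g "-1"]] by simp

lemma L2_continuous:
  assumes "continuous_on {0..1} f"
  shows "f \<in> L2"
proof -
  have "bounded (f ` {0..1})"
    by (intro compact_imp_bounded compact_continuous_image assms) auto
  then obtain B where "\<And>x. x \<in> {0..1} \<Longrightarrow> \<bar>f x\<bar> \<le> B"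
    unfolding bounded_iff by force
  moreover have "f \<in> borel_measurable M"
    by (rule continuous_imp_measurable_on_sets_lebesgue)
      (auto intro: continuous_on_subset[OF assms])
  ultimately show ?thesis
    by (intro L2_bounded[of f B]) auto
qed

lemma test_fun_L2: "test_fun \<phi> \<Longrightarrow> \<phi> \<in> L2"
  by (intro L2_continuous test_fun_continuous)

lemmas L2_intros = L2_const L2_cmult L2_add L2_diff

lemma l2_inner_commute: "l2_inner f g = l2_inner g f"
  by (simp add: l2_inner_def mult.commute)

lemma l2_inner_add_left:
  "f \<in> L2 \<Longrightarrow> g \<in> L2 \<Longrightarrow> h \<in> L2 \<Longrightarrow> l2_inner (\<lambda>x. f x + g x) h = l2_inner f h + l2_inner g h"
  by (simp add: l2_inner_def distrib_right L2_mult_integrable)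

lemma l2_inner_diff_left:
  "f \<in> L2 \<Longrightarrow> g \<in> L2 \<Longrightarrow> h \<in> L2 \<Longrightarrow> l2_inner (\<lambda>x. f x - g x) h = l2_inner f h - l2_inner g h"
  by (simp add: l2_inner_def left_diff_distrib L2_mult_integrable)

lemma l2_inner_cmult_left: "l2_inner (\<lambda>x. c * f x) h = c * l2_inner f h"
  by (simp add: l2_inner_def mult.assoc)

lemma l2_inner_add_right:
  "f \<in> L2 \<Longrightarrow> g \<in> L2 \<Longrightarrow> h \<in> L2 \<Longrightarrow> l2_inner h (\<lambda>x. f x + g x) = l2_inner h f + l2_inner h g"
  by (simp add: l2_inner_commute[of h] l2_inner_add_left)

lemma l2_inner_diff_right:
  "f \<in> L2 \<Longrightarrow> g \<in> L2 \<Longrightarrow> h \<in> L2 \<Longrightarrow> l2_inner h (\<lambda>x. f x - g x) = l2_inner h f - l2_inner h g"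
  by (simp add: l2_inner_commute[of h] l2_inner_diff_left)

lemma l2_inner_cmult_right: "l2_inner h (\<lambda>x. c * f x) = c * l2_inner h f"
  by (simp add: l2_inner_commute[of h] l2_inner_cmult_left)

lemmas l2_inner_simps = l2_inner_add_left l2_inner_diff_left l2_inner_cmult_left
  l2_inner_add_right l2_inner_diff_right l2_inner_cmult_right

lemma l2_inner_cong_AE:
  assumes "AE x in M. f x = f' x" "AE x in M. g x = g' x" "f \<in> L2" "f' \<in> L2" "g \<in> L2" "g' \<in> L2"
  shows "l2_inner f g = l2_inner f' g'"
  unfolding l2_inner_def
proof (rule integral_cong_AE)
  show "AE x in M. f x * g x = f' x * g' x"
    using assms(1,2) by eventually_elim simp
qed (use assms(3-6)[THEN L2_measurable] in simp_all)

lemma l2_inner_nonneg: "0 \<le> l2_inner f f"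
  by (simp add: l2_inner_def)

lemma l2_norm_nonneg: "0 \<le> l2_norm f"
  by (simp add: l2_norm_def l2_inner_nonneg)

lemma l2_norm_sq: "(l2_norm f)\<^sup>2 = l2_inner f f"
  by (simp add: l2_norm_def l2_inner_nonneg)

lemma l2_norm_cmult: "l2_norm (\<lambda>x. c * f x) = \<bar>c\<bar> * l2_norm f"
proof -
  have "l2_inner (\<lambda>x. c * f x) (\<lambda>x. c * f x) = c\<^sup>2 * l2_inner f f"
    by (simp add: l2_inner_cmult_left l2_inner_cmult_right power2_eq_square)
  then show ?thesis
    by (simp add: l2_norm_def real_sqrt_mult)
qed

text \<open>The usual argument from \<open>0 \<le> \<parallel>a * f - b * g\<parallel>\<^sup>2\<close>; the case \<open>\<parallel>g\<parallel> = 0\<close> is treated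
  separately because \<open>g\<close> need only vanish almost everywhere.\<close>
lemma l2_Cauchy_Schwarz:
  assumes f: "f \<in> L2" and g: "g \<in> L2"
  shows "\<bar>l2_inner f g\<bar> \<le> l2_norm f * l2_norm g"
proof -
  have expand: "0 \<le> a\<^sup>2 * l2_inner f f - 2 * a * b * l2_inner f g + b\<^sup>2 * l2_inner g g" for a b
  proof -
    have "0 \<le> l2_inner (\<lambda>x. a * f x - b * g x) (\<lambda>x. a * f x - b * g x)"
      by (rule l2_inner_nonneg)
    also have "\<dots> = a\<^sup>2 * l2_inner f f - 2 * a * b * l2_inner f g + b\<^sup>2 * l2_inner g g"
      using f g by (simp add: l2_inner_simps L2_intros l2_inner_commute[of g f] algebra_simps power2_eq_square)
    finally show ?thesis .
  qed
  define A B C where "A = l2_norm f" and "B = l2_inner f g" and "C = l2_norm g"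
  have nn: "0 \<le> A" "0 \<le> C"
    by (auto simp: A_def C_def l2_norm_nonneg)
  have ineq: "2 * a * b * B \<le> a\<^sup>2 * A\<^sup>2 + b\<^sup>2 * C\<^sup>2" for a b
    using expand[of a b] by (simp add: A_def B_def C_def l2_norm_sq)
  have "B\<^sup>2 \<le> (A * C)\<^sup>2"
  proof (cases "C = 0")
    case True
    have "B = 0"
    proof (rule ccontr)
      assume "B \<noteq> 0"
      with ineq[of 1 "(A\<^sup>2 + 1) / B"] True have "A\<^sup>2 + 2 \<le> 0"
        by simp
      then show False
        using zero_le_power2[of A] by linarith
    qed
    then show ?thesis by simp
  next
    case False
    have "2 * (C\<^sup>2 * B\<^sup>2) \<le> C\<^sup>2 * (C\<^sup>2 * A\<^sup>2 + B\<^sup>2)"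
      using ineq[of "C\<^sup>2" B] by (simp add: algebra_simps power2_eq_square)
    then have "C\<^sup>2 * (2 * B\<^sup>2) \<le> C\<^sup>2 * (C\<^sup>2 * A\<^sup>2 + B\<^sup>2)"
      by (simp add: algebra_simps)
    then have "2 * B\<^sup>2 \<le> C\<^sup>2 * A\<^sup>2 + B\<^sup>2"
      using False by (subst (asm) mult_le_cancel_left_pos) auto
    then show ?thesis
      by (simp add: power_mult_distrib mult.commute)
  qed
  then have "\<bar>B\<bar> \<le> \<bar>A * C\<bar>"
    by (simp only: abs_le_square_iff)
  then show ?thesis
    using nn by (simp add: A_def B_def C_def)
qed

section \<open>Weak derivatives\<close>

lemma weak_derivD:
  assumes "weak_deriv k w g"
  shows "w \<in> L2" "g \<in> L2"
    "\<And>\<phi>. test_fun \<phi> \<Longrightarrow> l2_inner w ((deriv ^^ k) \<phi>) = (-1) ^ k * l2_inner g \<phi>"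
  using assms by (auto simp: weak_deriv_def)

lemma weak_deriv_unique:
  assumes "weak_deriv k w g" "weak_deriv k w h"
  shows "AE x in M. g x = h x"
proof -
  note g = weak_derivD[OF assms(1)] and h = weak_derivD[OF assms(2)]
  have "AE x in M. g x - h x = 0"
  proof (rule fundamental_lemma)
    show "integrable M (\<lambda>x. g x - h x)"
      by (intro L2_integrable L2_diff g h)
    fix \<phi> assume \<phi>: "test_fun \<phi>"
    then have "l2_inner (\<lambda>x. g x - h x) \<phi> = 0"
      using g h by (simp add: l2_inner_diff_left test_fun_L2)
    then show "(\<integral>x. (g x - h x) * \<phi> x \<partial>M) = 0"
      by (simp add: l2_inner_def)
  qed
  then show ?thesis by simp
qed

lemma weak_deriv_wderiv: "weak_deriv k w g \<Longrightarrow> weak_deriv k w (wderiv k w)"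
  unfolding wderiv_def by (rule someI[of "weak_deriv k w"])

lemma wderiv_AE: "weak_deriv k w g \<Longrightarrow> AE x in M. wderiv k w x = g x"
  by (rule weak_deriv_unique[OF weak_deriv_wderiv])

lemma sobolev_weak_deriv: "w \<in> sobolev n \<Longrightarrow> k \<le> n \<Longrightarrow> weak_deriv k w (wderiv k w)"
  by (auto simp: sobolev_def intro: weak_deriv_wderiv)

lemma weak_deriv_lincomb:
  assumes "weak_deriv k w g" "weak_deriv k v h"
  shows "weak_deriv k (\<lambda>x. a * w x + b * v x) (\<lambda>x. a * g x + b * h x)"
proof -
  note g = weak_derivD[OF assms(1)] and h = weak_derivD[OF assms(2)]
  have "l2_inner (\<lambda>x. a * w x + b * v x) ((deriv ^^ k) \<phi>) = (-1) ^ k * l2_inner (\<lambda>x. a * g x + b * h x) \<phi>"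
    if "test_fun \<phi>" for \<phi>
  proof -
    have "\<phi> \<in> L2" "(deriv ^^ k) \<phi> \<in> L2"
      using that by (simp_all add: test_fun_L2 test_fun_derivs)
    then show ?thesis
      using that by (simp add: l2_inner_simps L2_intros g h distrib_left)
  qed
  then show ?thesis
    by (simp add: weak_deriv_def L2_intros g h)
qed

lemma weak_deriv_diff:
  "weak_deriv k w g \<Longrightarrow> weak_deriv k v h \<Longrightarrow> weak_deriv k (\<lambda>x. w x - v x) (\<lambda>x. g x - h x)"
  using weak_deriv_lincomb[of k w g v h 1 "-1"] by simp

lemma weak_deriv_cmult:
  "weak_deriv k w g \<Longrightarrow> weak_deriv k (\<lambda>x. c * w x) (\<lambda>x. c * g x)"
  using weak_deriv_lincomb[of k w g w g c 0] by simp

text \<open>Derivatives of test functions are test functions, so they may be inserted into the defining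
  identity of the lower derivative.\<close>
lemma weak_deriv_weak_deriv:
  assumes "weak_deriv j w g" "weak_deriv (k + j) w h"
  shows "weak_deriv k g h"
proof -
  note g = weak_derivD[OF assms(1)] and h = weak_derivD[OF assms(2)]
  have "l2_inner g ((deriv ^^ k) \<phi>) = (-1) ^ k * l2_inner h \<phi>" if "test_fun \<phi>" for \<phi>
  proof -
    have "(-1) ^ j * l2_inner g ((deriv ^^ k) \<phi>) = l2_inner w ((deriv ^^ (j + k)) \<phi>)"
      using g(3)[OF test_fun_derivs[OF that, of k]] by (simp add: funpow_add)
    also have "\<dots> = (-1) ^ j * ((-1) ^ k * l2_inner h \<phi>)"
      using h(3)[OF that] by (simp add: add.commute[of j k] power_add mult_ac)
    finally show ?thesis by simp
  qed
  with g h show ?thesis by (simp add: weak_deriv_def)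
qed

lemma sobolev_wderiv:
  assumes "w \<in> sobolev (n + k)"
  shows "wderiv k w \<in> sobolev n"
proof -
  have "weak_deriv j (wderiv k w) (wderiv (j + k) w)" if "j \<le> n" for j
    using that by (intro weak_deriv_weak_deriv[of k w _ j] sobolev_weak_deriv[OF assms]) auto
  moreover from this have "wderiv k w \<in> L2"
    using weak_derivD(1) by blast
  ultimately show ?thesis
    unfolding sobolev_def by blast
qed

lemma sobolevI: "w \<in> L2 \<Longrightarrow> (\<And>j. j \<le> n \<Longrightarrow> weak_deriv j w (g j)) \<Longrightarrow> w \<in> sobolev n"
  unfolding sobolev_def by blast

lemma sobolev_L2: "w \<in> sobolev n \<Longrightarrow> w \<in> L2"
  by (simp add: sobolev_def)

lemma sobolev_diff: "w \<in> sobolev n \<Longrightarrow> v \<in> sobolev n \<Longrightarrow> (\<lambda>x. w x - v x) \<in> sobolev n"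
  by (rule sobolevI, rule L2_diff, (simp add: sobolev_L2)+)
    (rule weak_deriv_diff; rule sobolev_weak_deriv)

lemma sobolev_cmult: "w \<in> sobolev n \<Longrightarrow> (\<lambda>x. c * w x) \<in> sobolev n"
  by (rule sobolevI, rule L2_cmult, simp add: sobolev_L2)
    (rule weak_deriv_cmult, rule sobolev_weak_deriv)

section \<open>Primitives and integration by parts\<close>

text \<open>Integrating over \<open>Omega\<close> against an indicator, instead of over an interval depending on \<open>x\<close>,
  gives iterated primitives the form in which Fubini's theorem applies.\<close>
definition primitive :: "(real \<Rightarrow> real) \<Rightarrow> real \<Rightarrow> real" where
  "primitive f x = (\<integral>s. f s * indicator {0<..<x} s \<partial>M)"

lemma integrable_indicator_M:
  fixes f :: "real \<Rightarrow> real"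
  assumes "integrable M f" "A \<in> sets borel"
  shows "integrable M (\<lambda>s. f s * indicator A s)"
  by (rule integrable_M_mult_bounded[OF assms(1) borel_measurable_M, of _ 1])
    (use assms(2) in \<open>auto simp: indicator_def\<close>)

lemma primitive_0: "primitive f 0 = 0"
  by (simp add: primitive_def)

lemma primitive_1: "primitive f 1 = (\<integral>s. f s \<partial>M)"
  unfolding primitive_def by (rule Bochner_Integration.integral_cong) auto

lemma primitive_cong_AE:
  assumes "AE s in M. f s = g s" "integrable M f" "integrable M g"
  shows "primitive f x = primitive g x"
  unfolding primitive_def
proof (rule integral_cong_AE)
  show "AE s in M. f s * indicator {0<..<x} s = g s * indicator {0<..<x} s"
    using assms(1) by eventually_elim simp
qed (use assms integrable_indicator_M in \<open>auto intro!: borel_measurable_integrable\<close>)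

lemma primitive_has_integral:
  assumes f: "integrable M f" and x: "0 \<le> x" "x \<le> 1"
  shows "(f has_integral primitive f x) {0..x}"
proof -
  have "((\<lambda>s. f s * indicator {0<..<x} s) has_integral primitive f x) Omega"
    unfolding primitive_def by (intro has_integral_integral_lebesgue_on integrable_indicator_M f) auto
  also have "(\<lambda>s. f s * indicator {0<..<x} s) = (\<lambda>s. if s \<in> {0<..<x} then f s else 0)"
    by (auto simp: indicator_def)
  finally have "(f has_integral primitive f x) {0<..<x}"
    using x by (subst (asm) has_integral_restrict) auto
  then show ?thesis
    by (simp add: has_integral_Icc_iff_Ioo)
qed

text \<open>The fundamental theorem of calculus, which connects \<open>primitive\<close> with classical antiderivatives.\<close>
lemma primitive_eqI:
  assumes "integrable M f" "0 \<le> x" "x \<le> 1" "\<And>s. s \<in> {0..x} \<Longrightarrow> (F has_real_derivative f s) (at s within {0..x})"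
  shows "primitive f x = F x - F 0"
proof (rule has_integral_unique[OF primitive_has_integral[OF assms(1-3)]])
  show "(f has_integral F x - F 0) {0..x}"
    by (rule fundamental_theorem_of_calculus)
      (use assms in \<open>auto simp: has_real_derivative_iff_has_vector_derivative[symmetric]\<close>)
qed

lemma primitive_continuous:
  assumes f: "integrable M f"
  shows "continuous_on S (primitive f)"
proof (rule continuous_at_imp_continuous_on, intro ballI)
  fix x
  show "isCont (primitive f) x"
  proof (rule continuous_at_sequentiallyI)
    fix u assume u: "u \<longlonglongrightarrow> x"
    show "(\<lambda>n. primitive f (u n)) \<longlonglongrightarrow> primitive f x"
      unfolding primitive_def
    proof (rule integral_dominated_convergence)
      show "integrable M (\<lambda>s. \<bar>f s\<bar>)"
        using f by simp
      show "AE s in M. (\<lambda>n. f s * indicator {0<..<u n} s) \<longlonglongrightarrow> f s * indicator {0<..<x} s"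
        using AE_M_neq[of x]
      proof eventually_elim
        fix s assume s: "s \<noteq> x"
        have "\<forall>\<^sub>F n in sequentially. indicator {0<..<x} s = (indicator {0<..<u n} s :: real)"
        proof (cases "s < x")
          case True
          from order_tendstoD(1)[OF u this] show ?thesis
            by eventually_elim (use True in \<open>auto simp: indicator_def\<close>)
        next
          case False
          then have "x < s" using s by simp
          from order_tendstoD(2)[OF u this] show ?thesis
            by eventually_elim (use False in \<open>auto simp: indicator_def\<close>)
        qed
        then have "(\<lambda>n. indicator {0<..<u n} s :: real) \<longlonglongrightarrow> indicator {0<..<x} s"
          by (rule Lim_transform_eventually[OF tendsto_const])
        then show "(\<lambda>n. f s * indicator {0<..<u n} s) \<longlonglongrightarrow> f s * indicator {0<..<x} s"
          by (intro tendsto_mult tendsto_const)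
      qed
      show "AE s in M. norm (f s * indicator {0<..<u n} s) \<le> \<bar>f s\<bar>" for n
        by (intro AE_I2) (auto simp: indicator_def)
    qed (use integrable_indicator_M[OF f] in \<open>auto intro!: borel_measurable_integrable\<close>)
  qed
qed

lemma primitive_L2: "integrable M f \<Longrightarrow> primitive f \<in> L2"
  by (intro L2_continuous primitive_continuous)

lemma integrable_mult_primitive:
  assumes "integrable M k" "integrable M g"
  shows "integrable M (\<lambda>x. k x * primitive g x)"
proof -
  have "bounded (primitive g ` {0..1})"
    by (intro compact_imp_bounded compact_continuous_image primitive_continuous assms) auto
  then obtain B where "\<And>x. x \<in> {0..1} \<Longrightarrow> \<bar>primitive g x\<bar> \<le> B"
    unfolding bounded_iff by force
  then show ?thesis
    by (intro integrable_M_mult_bounded[of _ _ B] assms L2_measurable primitive_L2) auto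
qed

text \<open>The unit square is cut along its diagonal: each summand on the left is the integral of
  \<open>k x * g s\<close> over one of the two triangles, by Fubini's theorem, and the diagonal is a null set.\<close>
lemma primitive_integral_by_parts:
  assumes k: "integrable M k" and g: "integrable M g"
  shows "(\<integral>x. k x * primitive g x \<partial>M) + (\<integral>x. g x * primitive k x \<partial>M) = (\<integral>x. k x \<partial>M) * (\<integral>x. g x \<partial>M)"
proof -
  interpret P: pair_sigma_finite M M
    by (simp add: pair_sigma_finite_def M.sigma_finite_measure_axioms)
  let ?f = "\<lambda>x s. k s * g x * indicator {0<..<x} s"
  have kM: "k \<in> borel_measurable M" and gM: "g \<in> borel_measurable M"
    using k g by auto
  have [measurable]: "(\<lambda>z. k (snd z)) \<in> borel_measurable (M \<Otimes>\<^sub>M M)"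
      "(\<lambda>z. g (fst z)) \<in> borel_measurable (M \<Otimes>\<^sub>M M)"
    using measurable_compose[OF measurable_snd kM] measurable_compose[OF measurable_fst gM] by auto
  have [measurable]: "fst \<in> borel_measurable (M \<Otimes>\<^sub>M M)" "snd \<in> borel_measurable (M \<Otimes>\<^sub>M M)"
    using measurable_compose[OF measurable_snd borel_measurable_M[OF measurable_ident_sets[OF refl]]]
      measurable_compose[OF measurable_fst borel_measurable_M[OF measurable_ident_sets[OF refl]]] by auto
  have "integrable (M \<Otimes>\<^sub>M M) (\<lambda>z. k (snd z) * g (fst z))"
    by (rule P.Fubini_integrable) (use k g in \<open>auto simp: abs_mult\<close>)
  moreover have "(\<lambda>z. k (snd z) * g (fst z) * (if 0 < snd z \<and> snd z < fst z then 1 else 0))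
      \<in> borel_measurable (M \<Otimes>\<^sub>M M)"
    by measurable
  ultimately have "integrable (M \<Otimes>\<^sub>M M)
      (\<lambda>z. k (snd z) * g (fst z) * (if 0 < snd z \<and> snd z < fst z then 1 else 0))"
    by (rule Bochner_Integration.integrable_bound) auto
  moreover have "(\<lambda>z. k (snd z) * g (fst z) * (if 0 < snd z \<and> snd z < fst z then 1 else 0)) = case_prod ?f"
    by (auto simp: fun_eq_iff indicator_def)
  ultimately have int: "integrable (M \<Otimes>\<^sub>M M) (case_prod ?f)"
    by simp
  have "(\<integral>x. g x * primitive k x \<partial>M) = (\<integral>x. (\<integral>s. ?f x s \<partial>M) \<partial>M)"
    by (simp add: primitive_def mult_ac flip: integral_mult_right_zero)
  also have "\<dots> = (\<integral>s. (\<integral>x. ?f x s \<partial>M) \<partial>M)"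
    by (rule P.Fubini_integral[OF int, symmetric])
  also have "\<dots> = (\<integral>s. k s * ((\<integral>x. g x \<partial>M) - primitive g s) \<partial>M)"
  proof (rule Bochner_Integration.integral_cong[OF refl])
    fix s assume "s \<in> space M"
    then have s: "0 < s" "s < 1" by auto
    have "(\<integral>x. ?f x s \<partial>M) = k s * (\<integral>x. g x - g x * indicator {0<..<s} x \<partial>M)"
    proof (subst integral_mult_right_zero[symmetric], rule integral_cong_AE)
      show "AE x in M. ?f x s = k s * (g x - g x * indicator {0<..<s} x)"
        using AE_M_neq[of s] AE_space[of M]
        by eventually_elim (use s in \<open>auto simp: indicator_def\<close>)
      have "(\<lambda>x. g x * indicator {s<..} x) \<in> borel_measurable M"
        by (intro borel_measurable_integrable integrable_indicator_M g) auto
      then have "(\<lambda>x. k s * (g x * indicator {s<..} x)) \<in> borel_measurable M"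
        by simp
      also have "(\<lambda>x. k s * (g x * indicator {s<..} x)) = (\<lambda>x. ?f x s)"
        using s by (auto simp: indicator_def)
      finally show "(\<lambda>x. ?f x s) \<in> borel_measurable M" .
    qed (use integrable_indicator_M[OF g] g in \<open>auto intro!: borel_measurable_integrable\<close>)
    also have "\<dots> = k s * ((\<integral>x. g x \<partial>M) - primitive g s)"
      unfolding primitive_def by (subst Bochner_Integration.integral_diff) (auto intro!: g integrable_indicator_M)
    finally show "(\<integral>x. ?f x s \<partial>M) = k s * ((\<integral>x. g x \<partial>M) - primitive g s)" .
  qed
  also have "\<dots> = (\<integral>s. k s * (\<integral>x. g x \<partial>M) - k s * primitive g s \<partial>M)"
    by (simp add: right_diff_distrib)
  also have "\<dots> = (\<integral>x. k x \<partial>M) * (\<integral>x. g x \<partial>M) - (\<integral>x. k x * primitive g x \<partial>M)"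
    by (subst Bochner_Integration.integral_diff) (auto intro!: k g integrable_mult_primitive)
  finally show ?thesis by simp
qed

text \<open>The primitive vanishes to the left of the support of \<open>\<psi>\<close>, and to the right of it because \<open>\<psi>\<close>
  has mean zero; hence it has compact support again.\<close>
lemma test_fun_antideriv:
  assumes \<psi>: "test_fun \<psi>" and zero: "(\<integral>x. \<psi> x \<partial>M) = 0"
  obtains \<Psi> where "test_fun \<Psi>" "deriv \<Psi> = \<psi>" "\<And>x. x \<in> {0..1} \<Longrightarrow> \<Psi> x = primitive \<psi> x"
proof -
  obtain a b where ab: "0 < a" "a < b" "b < 1" "\<And>x. \<psi> x \<noteq> 0 \<Longrightarrow> a < x \<and> x < b"
    using test_fun_support[OF \<psi>] by metis
  define \<Psi> where "\<Psi> x = integral {0..x} \<psi>" for x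
  have int: "\<psi> integrable_on {c..d}" for c d
    by (intro integrable_continuous_interval test_fun_continuous \<psi>)
  have low: "\<Psi> x = 0" if "x < a" for x
  proof -
    have "integral {0..x} \<psi> = integral {0..x} (\<lambda>_. 0)"
      using ab(4) that by (intro integral_cong) force
    then show ?thesis by (simp add: \<Psi>_def)
  qed
  have primitive: "\<Psi> x = primitive \<psi> x" if "x \<in> {0..1}" for x
    using primitive_has_integral[OF L2_integrable[OF test_fun_L2[OF \<psi>]], of x] that
    by (simp add: \<Psi>_def integral_unique)
  (* To the right of the support the integral is the full mean, which is zero. *)
  have high: "\<Psi> x = 0" if "b < x" for x
  proof -
    have "(\<psi> has_integral 0) {0..b}"
    proof -
      have "(\<psi> has_integral 0) {0..1}"
        using primitive_has_integral[OF L2_integrable[OF test_fun_L2[OF \<psi>]], of 1] zero by (simp add: primitive_1)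
      moreover have "(\<psi> has_integral 0) {b..1}"
        using ab(4) by (intro has_integral_is_0) force
      moreover have "(\<psi> has_integral integral {0..b} \<psi>) {0..b}"
        using int has_integral_integral by blast
      ultimately have "integral {0..b} \<psi> + 0 = 0"
        using ab by (intro has_integral_unique[OF has_integral_combine[of 0 b 1 \<psi>]]) auto
      then show ?thesis
        using \<open>(\<psi> has_integral integral {0..b} \<psi>) {0..b}\<close> by simp
    qed
    moreover have "(\<psi> has_integral 0) {b..x}"
      using ab(4) by (intro has_integral_is_0) force
    ultimately have "(\<psi> has_integral 0 + 0) {0..x}"
      using that ab by (intro has_integral_combine[of 0 b x]) auto
    then show ?thesis
      by (simp add: \<Psi>_def integral_unique)
  qed
  have D: "(\<Psi> has_real_derivative \<psi> x) (at x)" for x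
  proof (cases "x < a")
    case True
    have "((\<lambda>_. 0) has_real_derivative 0) (at x)"
      by simp
    then have "(\<Psi> has_real_derivative 0) (at x)"
      by (rule has_field_derivative_transform_within_open[where S="{..<a}"]) (use True low in auto)
    moreover have "\<psi> x = 0"
      using ab(4)[of x] True by force
    ultimately show ?thesis by simp
  next
    case False
    have "(\<Psi> has_real_derivative \<psi> x) (at x within {0..x+1})"
      unfolding \<Psi>_def using False ab
      by (intro integral_has_real_derivative test_fun_continuous \<psi>) auto
    then show ?thesis
      using False ab by (subst (asm) at_within_interior) auto
  qed
  show thesis
  proof (rule that[OF _ _ primitive])
    show "test_fun \<Psi>"
    proof (rule test_funI[OF smooth_antideriv[OF D test_fun_smooth[OF \<psi>]] ab(1,3)])
      show "a \<le> x \<and> x \<le> b" if "\<Psi> x \<noteq> 0" for x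
        using low[of x] high[of x] that by force
    qed
    show "deriv \<Psi> = \<psi>"
      using D by (auto intro: DERIV_imp_deriv)
  qed
qed

text \<open>The integrals of the bump functions tend to 1, so one of them is nonzero and can be scaled.\<close>
lemma test_fun_normalised:
  obtains \<phi> where "test_fun \<phi>" "(\<integral>x. \<phi> x \<partial>M) = 1"
proof -
  have "(\<lambda>n. \<integral>x. 1 * bump (Suc n) 1 x \<partial>M) \<longlonglongrightarrow> (\<integral>x. 1 * indicator {0<..<1} x \<partial>M)"
    by (rule bump_integral_tendsto) simp
  moreover have "(\<integral>x. 1 * indicator {0<..<1::real} x \<partial>M) = (1::real)"
    using primitive_1[of "\<lambda>_. 1"] primitive_eqI[of "\<lambda>_. 1" 1 "\<lambda>x. x"] by (simp add: primitive_def)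
  ultimately have lim: "(\<lambda>n. \<integral>x. bump (Suc n) 1 x \<partial>M) \<longlonglongrightarrow> 1"
    by simp
  have "\<not> (\<forall>n. (\<integral>x. bump (Suc n) 1 x \<partial>M) = 0)"
  proof
    assume "\<forall>n. (\<integral>x. bump (Suc n) 1 x \<partial>M) = 0"
    then show False
      using lim by (simp add: LIMSEQ_const_iff)
  qed
  then obtain n where n: "(\<integral>x. bump (Suc n) 1 x \<partial>M) \<noteq> 0"
    by blast
  show thesis
  proof (rule that)
    show "test_fun (\<lambda>x. inverse (\<integral>x. bump (Suc n) 1 x \<partial>M) * bump (Suc n) 1 x)"
      by (intro test_fun_cmult bump_test_fun) auto
    show "(\<integral>x. inverse (\<integral>x. bump (Suc n) 1 x \<partial>M) * bump (Suc n) 1 x \<partial>M) = 1"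
      using n by simp
  qed
qed

text \<open>The lemma of du Bois-Reymond. A test function \<open>\<phi>\<close> is corrected by a multiple of a fixed
  normalised \<open>\<psi>0\<close> to have mean zero; the result is the derivative of a test function \<open>\<Psi>\<close>, and
  inserting \<open>\<Psi>\<close> into the definition of the weak derivative shows that \<open>q - primitive r\<close> is
  orthogonal to the corrected function. So \<open>q - primitive r\<close> acts on \<open>\<phi>\<close> like a constant.\<close>
lemma weak_deriv_imp_primitive:
  assumes qr: "weak_deriv 1 q r"
  obtains c where "AE x in M. q x = c + primitive r x"
proof -
  note w = weak_derivD[OF qr]
  have pr: "primitive r \<in> L2"
    by (intro primitive_L2 L2_integrable w)
  obtain \<psi>0 where \<psi>0: "test_fun \<psi>0" "(\<integral>x. \<psi>0 x \<partial>M) = 1"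
    using test_fun_normalised by metis
  define c where "c = l2_inner (\<lambda>x. q x - primitive r x) \<psi>0"
  have "AE x in M. q x - primitive r x - c = 0"
  proof (rule fundamental_lemma)
    show "integrable M (\<lambda>x. q x - primitive r x - c)"
      by (intro L2_integrable L2_intros w pr)
    fix \<phi> assume \<phi>: "test_fun \<phi>"
    define m where "m = (\<integral>x. \<phi> x \<partial>M)"
    define \<psi> where "\<psi> = (\<lambda>x. \<phi> x + (- m) * \<psi>0 x)"
    have \<psi>: "test_fun \<psi>"
      unfolding \<psi>_def by (intro test_fun_add test_fun_cmult \<phi> \<psi>0)
    have iM: "integrable M \<phi>" "integrable M \<psi>0"
      using \<phi> \<psi>0 by (auto intro: L2_integrable test_fun_L2)
    then have z: "(\<integral>x. \<psi> x \<partial>M) = 0"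
      using \<psi>0(2) unfolding \<psi>_def by (subst Bochner_Integration.integral_add) (auto simp: m_def)
    obtain \<Psi> where \<Psi>: "test_fun \<Psi>" "deriv \<Psi> = \<psi>" "\<And>x. x \<in> {0..1} \<Longrightarrow> \<Psi> x = primitive \<psi> x"
      using test_fun_antideriv[OF \<psi> z] by metis
    have "l2_inner q \<psi> = - l2_inner r \<Psi>"
      using w(3)[OF \<Psi>(1)] \<Psi>(2) by simp
    also have "l2_inner r \<Psi> = (\<integral>x. r x * primitive \<psi> x \<partial>M)"
      unfolding l2_inner_def by (rule Bochner_Integration.integral_cong) (use \<Psi>(3) in auto)
    also have "\<dots> = - (\<integral>x. \<psi> x * primitive r x \<partial>M)"
      using primitive_integral_by_parts[OF L2_integrable[OF w(2)] L2_integrable[OF test_fun_L2[OF \<psi>]]] z by simp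
    also have "(\<integral>x. \<psi> x * primitive r x \<partial>M) = l2_inner (primitive r) \<psi>"
      by (simp add: l2_inner_def mult.commute)
    finally have "l2_inner (\<lambda>x. q x - primitive r x) \<psi> = 0"
      by (simp add: l2_inner_diff_left w pr test_fun_L2[OF \<psi>])
    moreover have "l2_inner (\<lambda>x. q x - primitive r x) \<psi> = l2_inner (\<lambda>x. q x - primitive r x) \<phi> + (- m) * c"
      unfolding \<psi>_def c_def using w pr \<phi> \<psi>0(1)
      by (simp only: l2_inner_add_right l2_inner_cmult_right L2_diff L2_cmult test_fun_L2)
    ultimately have "l2_inner (\<lambda>x. q x - primitive r x) \<phi> = m * c"
      by simp
    moreover have "l2_inner (\<lambda>x. c) \<phi> = m * c"
      by (simp add: l2_inner_def m_def)
    ultimately have "l2_inner (\<lambda>x. q x - primitive r x - c) \<phi> = 0"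
      using w pr \<phi> by (subst l2_inner_diff_left) (auto intro: L2_diff L2_const test_fun_L2)
    then show "(\<integral>x. (q x - primitive r x - c) * \<phi> x \<partial>M) = 0"
      by (simp add: l2_inner_def)
  qed
  then have "AE x in M. q x = c + primitive r x"
    by eventually_elim simp
  then show thesis ..
qed

text \<open>The condition on \<open>k\<close> says that \<open>primitive k\<close> vanishes at both end points, so that there are no
  boundary terms; it also removes the additive constant in the representation of \<open>q\<close>.\<close>
lemma weak_deriv_integral_by_parts:
  assumes qr: "weak_deriv 1 q r" and k: "k \<in> L2" "(\<integral>x. k x \<partial>M) = 0"
  shows "l2_inner k q = - l2_inner (primitive k) r"
proof -
  note w = weak_derivD[OF qr]
  have pr: "primitive r \<in> L2"
    by (intro primitive_L2 L2_integrable w)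
  obtain c where c: "AE x in M. q x = c + primitive r x"
    using weak_deriv_imp_primitive[OF qr] .
  have "l2_inner k q = l2_inner k (\<lambda>x. c + primitive r x)"
    by (rule l2_inner_cong_AE) (use c k w pr in \<open>auto intro: L2_add L2_const\<close>)
  also have "\<dots> = l2_inner k (\<lambda>x. c) + l2_inner k (primitive r)"
    by (simp add: l2_inner_add_right L2_const pr k)
  also have "l2_inner k (\<lambda>x. c) = 0"
    using k by (simp add: l2_inner_def)
  also have "l2_inner k (primitive r) = - l2_inner (primitive k) r"
    using primitive_integral_by_parts[OF L2_integrable[OF k(1)] L2_integrable[OF w(2)]] k(2)
    by (simp add: l2_inner_def mult.commute)
  finally show ?thesis by simp
qed

text \<open>Transfers identities between continuous functions from almost every point of \<open>Omega\<close> to every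
  point of the closed interval, in particular to the end points.\<close>
lemma continuous_AE_zero:
  fixes f :: "real \<Rightarrow> real"
  assumes "continuous_on {0..1} f" "AE x in M. f x = 0" "x \<in> {0..1}"
  shows "f x = 0"
proof -
  have ac: "continuous_on {0..1} (\<lambda>x. \<bar>f x\<bar>)"
    by (intro continuous_intros assms)
  have "primitive (\<lambda>x. \<bar>f x\<bar>) 1 = primitive (\<lambda>x. 0) 1"
    by (rule primitive_cong_AE) (use assms(2) L2_integrable[OF L2_continuous[OF ac]] in auto)
  then have "((\<lambda>x. \<bar>f x\<bar>) has_integral 0) {0..1}"
    using primitive_has_integral[OF L2_integrable[OF L2_continuous[OF ac]], of 1] by (simp add: primitive_def)
  then show ?thesis
    using has_integral_0_cbox_imp_0[of 0 1 "\<lambda>x. \<bar>f x\<bar>" x] ac assms(3) by auto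
qed

text \<open>Two integrations by parts. The boundary conditions enter through the representatives: \<open>W\<close> is
  the primitive of \<open>W'\<close>, which has mean zero because \<open>W\<close> vanishes at both ends, and in the same
  way \<open>W'\<close> is the primitive of \<open>p''\<close>, which has mean zero because \<open>W'\<close> vanishes at both ends.\<close>
lemma H02_integral_by_parts:
  assumes "p \<in> H02" "q \<in> sobolev 2"
  shows "l2_inner p (wderiv 2 q) = l2_inner (wderiv 2 p) q"
proof -
  define p2 where "p2 = wderiv 2 p"
  have p2: "weak_deriv 2 p p2"
    using assms(1) unfolding p2_def by (intro sobolev_weak_deriv[of _ 2]) (auto simp: H02_def)
  note w = weak_derivD[OF p2]
  obtain W W' where W: "AE x in M. p x = W x"
    "\<And>x. x\<in>{0..1} \<Longrightarrow> (W has_real_derivative W' x) (at x within {0..1})"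
    "continuous_on {0..1} W'" "W 0 = 0" "W 1 = 0" "W' 0 = 0" "W' 1 = 0"
    using assms(1) unfolding H02_def by fastforce
  have contW: "continuous_on {0..1} W"
    using W(2) DERIV_continuous_on by blast
  note L2W = L2_continuous[OF contW] L2_continuous[OF W(3)]
  have primW: "primitive W' x = W x" if "x \<in> {0..1}" for x
  proof -
    have "primitive W' x = W x - W 0"
      by (rule primitive_eqI[OF L2_integrable[OF L2W(2)]]) (use that in \<open>auto intro!: DERIV_subset[OF W(2)]\<close>)
    then show ?thesis
      using W(4) by simp
  qed
  have zW: "(\<integral>x. W' x \<partial>M) = 0"
    using primW[of 1] W(5) by (simp add: primitive_1)
  (* p2 is known only as a second weak derivative of p; one classical integration by parts
     turns it into a first weak derivative of W'. *)
  have W'2: "weak_deriv 1 W' p2"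
    unfolding weak_deriv_def
  proof (intro conjI allI impI)
    fix \<phi> assume \<phi>: "test_fun \<phi>"
    note \<phi>' = test_fun_L2[OF test_fun_deriv[OF \<phi>]] test_fun_L2[OF test_fun_deriv[OF test_fun_deriv[OF \<phi>]]]
    have D2: "primitive (deriv (deriv \<phi>)) x = deriv \<phi> x" if "x \<in> {0..1}" for x
    proof -
      obtain a b where ab: "0 < a" "a < b" "b < 1" "\<And>x. deriv \<phi> x \<noteq> 0 \<Longrightarrow> a < x \<and> x < b"
        using test_fun_support[OF test_fun_deriv[OF \<phi>]] by metis
      have "deriv \<phi> 0 = 0"
        using ab(4)[of 0] ab(1) by force
      moreover have "primitive (deriv (deriv \<phi>)) x = deriv \<phi> x - deriv \<phi> 0"
        by (rule primitive_eqI) (use that in \<open>auto intro!: L2_integrable \<phi>' has_field_derivative_at_within smooth_DERIV test_fun_smooth test_fun_deriv \<phi>\<close>)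
      ultimately show ?thesis by simp
    qed
    have "l2_inner W' ((deriv ^^ 1) \<phi>) = (\<integral>x. W' x * primitive (deriv (deriv \<phi>)) x \<partial>M)"
      unfolding l2_inner_def by (rule Bochner_Integration.integral_cong) (auto simp: D2)
    also have "\<dots> = - (\<integral>x. deriv (deriv \<phi>) x * primitive W' x \<partial>M)"
      using primitive_integral_by_parts[of W' "deriv (deriv \<phi>)"] zW L2_integrable[OF L2W(2)] L2_integrable[OF \<phi>'(2)]
      by simp
    also have "(\<integral>x. deriv (deriv \<phi>) x * primitive W' x \<partial>M) = l2_inner W (deriv (deriv \<phi>))"
      unfolding l2_inner_def by (rule Bochner_Integration.integral_cong) (auto simp: primW)
    also have "\<dots> = l2_inner p (deriv (deriv \<phi>))"
      by (rule l2_inner_cong_AE) (use W(1) w L2W \<phi>' in \<open>auto elim: eventually_mono\<close>)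
    also have "\<dots> = l2_inner p2 \<phi>"
      using w(3)[OF \<phi>] by (simp add: numeral_2_eq_2)
    finally show "l2_inner W' ((deriv ^^ 1) \<phi>) = (- 1) ^ 1 * l2_inner p2 \<phi>"
      by simp
  qed (use L2W w in auto)
  obtain c where c: "AE x in M. W' x = c + primitive p2 x"
    using weak_deriv_imp_primitive[OF W'2] .
  have ip2: "integrable M p2"
    using w(2) by (rule L2_integrable)
  have W'p: "W' x - (c + primitive p2 x) = 0" if "x \<in> {0..1}" for x
    by (rule continuous_AE_zero[where f="\<lambda>x. W' x - (c + primitive p2 x)"])
      (use c that in \<open>auto intro!: continuous_intros W primitive_continuous ip2 elim: eventually_mono\<close>)
  have c0: "c = 0"
    using W'p[of 0] W(6) by (simp add: primitive_0)
  have zp2: "(\<integral>x. p2 x \<partial>M) = 0"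
    using W'p[of 1] W(7) c0 by (simp add: primitive_1)
  have q1: "weak_deriv 1 q (wderiv 1 q)" and q2: "weak_deriv 2 q (wderiv 2 q)"
    using assms(2) by (auto intro: sobolev_weak_deriv)
  have q12: "weak_deriv 1 (wderiv 1 q) (wderiv 2 q)"
    by (rule weak_deriv_weak_deriv[OF q1]) (use q2 in \<open>simp only: one_add_one\<close>)
  have "l2_inner p2 q = - l2_inner (primitive p2) (wderiv 1 q)"
    by (rule weak_deriv_integral_by_parts[OF q1 w(2) zp2])
  also have "l2_inner (primitive p2) (wderiv 1 q) = l2_inner W' (wderiv 1 q)"
    unfolding l2_inner_def by (rule Bochner_Integration.integral_cong) (use W'p c0 in auto)
  also have "\<dots> = - l2_inner (primitive W') (wderiv 2 q)"
    by (rule weak_deriv_integral_by_parts[OF q12 L2W(2) zW])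
  also have "l2_inner (primitive W') (wderiv 2 q) = l2_inner W (wderiv 2 q)"
    unfolding l2_inner_def by (rule Bochner_Integration.integral_cong) (auto simp: primW)
  also have "\<dots> = l2_inner p (wderiv 2 q)"
    by (rule l2_inner_cong_AE) (use W(1) w L2W weak_derivD(2)[OF q2] in \<open>auto elim: eventually_mono\<close>)
  finally show ?thesis
    by (simp add: p2_def)
qed

section \<open>The bilinear form in the balanced norm\<close>

lemma H02_sobolev: "w \<in> H02 \<Longrightarrow> w \<in> sobolev 2"
  by (simp add: H02_def)

lemma H02_diff:
  assumes "w \<in> H02" "v \<in> H02"
  shows "(\<lambda>x. w x - v x) \<in> H02"
proof -
  obtain W W' where W: "AE x in M. w x = W x"
    "\<forall>x\<in>{0..1}. (W has_real_derivative W' x) (at x within {0..1})"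
    "continuous_on {0..1} W'" "\<forall>\<xi>\<in>{0, 1}. W \<xi> = 0 \<and> W' \<xi> = 0"
    using assms(1) unfolding H02_def by fastforce
  obtain V V' where V: "AE x in M. v x = V x"
    "\<forall>x\<in>{0..1}. (V has_real_derivative V' x) (at x within {0..1})"
    "continuous_on {0..1} V'" "\<forall>\<xi>\<in>{0, 1}. V \<xi> = 0 \<and> V' \<xi> = 0"
    using assms(2) unfolding H02_def by fastforce
  have "AE x in M. w x - v x = W x - V x"
    using W(1) V(1) by eventually_elim simp
  moreover have "\<forall>x\<in>{0..1}. ((\<lambda>x. W x - V x) has_real_derivative W' x - V' x) (at x within {0..1})"
    using W(2) V(2) by (auto intro: DERIV_diff)
  moreover have "continuous_on {0..1} (\<lambda>x. W' x - V' x)"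
    using W(3) V(3) by (intro continuous_intros)
  moreover have "\<forall>\<xi>\<in>{0, 1}. W \<xi> - V \<xi> = 0 \<and> W' \<xi> - V' \<xi> = 0"
    using W(4) V(4) by simp
  ultimately show ?thesis
    unfolding H02_def using sobolev_diff[OF assms[THEN H02_sobolev]]
    by (intro CollectI conjI exI[of _ "\<lambda>x. W x - V x"] exI[of _ "\<lambda>x. W' x - V' x"])
qed

lemma fin_dim_subspace_diff:
  assumes "fin_dim_subspace S" "f \<in> S" "g \<in> S"
  shows "(\<lambda>x. f x - g x) \<in> S"
proof -
  have "(\<lambda>x. (-1) * g x) \<in> S" "\<And>h. h \<in> S \<Longrightarrow> (\<lambda>x. f x + h x) \<in> S"
    using assms unfolding fin_dim_subspace_def by blast+
  from this(2)[OF this(1)] show ?thesis by simp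
qed

lemma wderiv_L2: "w \<in> sobolev n \<Longrightarrow> k \<le> n \<Longrightarrow> wderiv k w \<in> L2"
  by (rule weak_derivD(2)[OF sobolev_weak_deriv])

lemma wderiv_diff_AE:
  assumes "w \<in> sobolev n" "v \<in> sobolev n" "k \<le> n"
  shows "AE x in M. wderiv k (\<lambda>x. w x - v x) x = wderiv k w x - wderiv k v x"
  by (intro wderiv_AE weak_deriv_diff sobolev_weak_deriv[where n=n] assms)

lemma l2_norm_cong_AE:
  assumes "AE x in M. f x = g x" "f \<in> L2" "g \<in> L2"
  shows "l2_norm f = l2_norm g"
  unfolding l2_norm_def using l2_inner_cong_AE[OF assms(1,1)] assms by simp

lemma eps_powr:
  assumes "0 < (\<epsilon> :: real)"
  shows "(\<epsilon> powr (3/2))\<^sup>2 = \<epsilon> ^ 3" "\<epsilon> powr (5/2) = \<epsilon> * \<epsilon> powr (3/2)"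
proof -
  have "(\<epsilon> powr (3/2))\<^sup>2 = \<epsilon> powr 3"
    by (simp add: power2_eq_square flip: powr_add)
  also have "\<dots> = \<epsilon> ^ 3"
    using assms by (simp flip: powr_numeral)
  finally show "(\<epsilon> powr (3/2))\<^sup>2 = \<epsilon> ^ 3" .
  have "\<epsilon> powr (1 + 3/2) = \<epsilon> * \<epsilon> powr (3/2)"
    using assms by (subst powr_add) simp
  then show "\<epsilon> powr (5/2) = \<epsilon> * \<epsilon> powr (3/2)"
    by simp
qed

text \<open>The four arguments of the inner products in \<open>bform\<close> all have this shape, so that bilinearity of
  \<open>bform\<close>, which for the chosen representatives \<open>wderiv\<close> holds only under integrals, needs one
  computation.\<close>
definition residual :: "real \<Rightarrow> (real \<Rightarrow> real) \<Rightarrow> real \<Rightarrow> (real \<Rightarrow> real) \<Rightarrow> real \<Rightarrow> real" where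
  "residual a w b v x = a * wderiv 2 w x + b * v x"

lemma bform_residual:
  "bform lam \<epsilon> (p, q) (p', q') =
    lam * l2_inner (residual (- (\<epsilon> powr (3/2))) p 1 q) (residual (- (\<epsilon> powr (3/2))) p' 1 q')
    + l2_inner (residual (\<epsilon> powr (5/2)) q 4 p) (residual (\<epsilon> powr (3/2)) q' 4 p')"
  by (simp add: residual_def[abs_def])

lemma residual_L2: "w \<in> sobolev 2 \<Longrightarrow> v \<in> sobolev 2 \<Longrightarrow> residual a w b v \<in> L2"
  unfolding residual_def[abs_def] by (intro L2_intros wderiv_L2[of _ 2] sobolev_L2[of _ 2]) auto

lemma residual_diff:
  assumes "w \<in> sobolev 2" "v \<in> sobolev 2" "w' \<in> sobolev 2" "v' \<in> sobolev 2" "g \<in> L2"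
  shows "l2_inner (residual a (\<lambda>x. w x - w' x) b (\<lambda>x. v x - v' x)) g
    = l2_inner (residual a w b v) g - l2_inner (residual a w' b v') g"
proof -
  have "l2_inner (residual a (\<lambda>x. w x - w' x) b (\<lambda>x. v x - v' x)) g
      = l2_inner (\<lambda>x. residual a w b v x - residual a w' b v' x) g"
  proof (rule l2_inner_cong_AE)
    show "AE x in M. residual a (\<lambda>x. w x - w' x) b (\<lambda>x. v x - v' x) x
        = residual a w b v x - residual a w' b v' x"
      using wderiv_diff_AE[OF assms(1,3) order_refl]
      by eventually_elim (simp add: residual_def right_diff_distrib)
  qed (use assms in \<open>simp_all add: residual_L2 sobolev_diff L2_diff\<close>)
  then show ?thesis
    using assms by (simp add: l2_inner_diff_left residual_L2)
qed

lemma residual_diff_right: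
  assumes "w \<in> sobolev 2" "v \<in> sobolev 2" "w' \<in> sobolev 2" "v' \<in> sobolev 2" "g \<in> L2"
  shows "l2_inner g (residual a (\<lambda>x. w x - w' x) b (\<lambda>x. v x - v' x))
    = l2_inner g (residual a w b v) - l2_inner g (residual a w' b v')"
  using residual_diff[OF assms] by (simp only: l2_inner_commute[of g])

lemma bform_diff_left:
  assumes "p \<in> sobolev 2" "q \<in> sobolev 2" "p1 \<in> sobolev 2" "q1 \<in> sobolev 2" "p2 \<in> sobolev 2" "q2 \<in> sobolev 2"
  shows "bform lam \<epsilon> (\<lambda>x. p1 x - p2 x, \<lambda>x. q1 x - q2 x) (p, q)
    = bform lam \<epsilon> (p1, q1) (p, q) - bform lam \<epsilon> (p2, q2) (p, q)"
  unfolding bform_residual using assms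
  by (simp add: residual_diff residual_L2 right_diff_distrib)

lemma bform_diff_right:
  assumes "p \<in> sobolev 2" "q \<in> sobolev 2" "p1 \<in> sobolev 2" "q1 \<in> sobolev 2" "p2 \<in> sobolev 2" "q2 \<in> sobolev 2"
  shows "bform lam \<epsilon> (p, q) (\<lambda>x. p1 x - p2 x, \<lambda>x. q1 x - q2 x)
    = bform lam \<epsilon> (p, q) (p1, q1) - bform lam \<epsilon> (p, q) (p2, q2)"
  unfolding bform_residual using assms
  by (simp add: residual_diff_right residual_L2 right_diff_distrib)

text \<open>The term \<open>l2_inner p (wderiv 2 q')\<close> is rewritten as \<open>l2_inner (wderiv 2 p) q'\<close>, which carries
  the weight that the balanced norm can control.\<close>
lemma bform_expand:
  assumes "p \<in> H02" "q \<in> sobolev 2" "p' \<in> H02" "q' \<in> sobolev 2" "0 < \<epsilon>"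
  defines "k \<equiv> \<epsilon> powr (3/2)"
  shows "bform lam \<epsilon> (p, q) (p', q') =
    lam * (l2_inner q q' - k * l2_inner q (wderiv 2 p') - k * l2_inner (wderiv 2 p) q'
           + k\<^sup>2 * l2_inner (wderiv 2 p) (wderiv 2 p'))
    + \<epsilon> ^ 4 * l2_inner (wderiv 2 q) (wderiv 2 q') + 4 * \<epsilon> * k * l2_inner (wderiv 2 q) p'
    + 4 * k * l2_inner (wderiv 2 p) q' + 16 * l2_inner p p'"
proof -
  note S = H02_sobolev[OF assms(1)] assms(2) H02_sobolev[OF assms(3)] assms(4)
  note mem = S[THEN sobolev_L2] S[THEN wderiv_L2[where k=2], simplified]
  have ibp: "l2_inner p (wderiv 2 q') = l2_inner (wderiv 2 p) q'"
    by (rule H02_integral_by_parts[OF assms(1,4)])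
  have e4: "\<epsilon> * (k * k) = \<epsilon> ^ 4"
    using eps_powr(1)[OF assms(5)] by (simp add: k_def power2_eq_square power_numeral_reduce)
  have "bform lam \<epsilon> (p, q) (p', q') =
     lam * l2_inner (\<lambda>x. q x - k * wderiv 2 p x) (\<lambda>x. q' x - k * wderiv 2 p' x)
     + l2_inner (\<lambda>x. (\<epsilon> * k) * wderiv 2 q x + 4 * p x) (\<lambda>x. k * wderiv 2 q' x + 4 * p' x)"
    using eps_powr(2)[OF assms(5)] by (simp add: k_def)
  also have "l2_inner (\<lambda>x. q x - k * wderiv 2 p x) (\<lambda>x. q' x - k * wderiv 2 p' x)
    = l2_inner q q' - k * l2_inner q (wderiv 2 p') - k * l2_inner (wderiv 2 p) q'
           + k\<^sup>2 * l2_inner (wderiv 2 p) (wderiv 2 p')"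
    by (simp add: l2_inner_simps L2_intros mem power2_eq_square, simp add: algebra_simps)
  also have "l2_inner (\<lambda>x. (\<epsilon> * k) * wderiv 2 q x + 4 * p x) (\<lambda>x. k * wderiv 2 q' x + 4 * p' x)
    = \<epsilon> * (k * k) * l2_inner (wderiv 2 q) (wderiv 2 q') + 4 * \<epsilon> * k * l2_inner (wderiv 2 q) p'
    + 4 * k * l2_inner (wderiv 2 p) q' + 16 * l2_inner p p'"
    by (simp add: l2_inner_simps L2_intros mem ibp, simp add: algebra_simps)
  finally show ?thesis
    by (simp add: e4)
qed

lemma bal_norm_sq:
  assumes "0 < \<epsilon>"
  shows "(bal_norm \<epsilon> (p, q))\<^sup>2 = (l2_norm p)\<^sup>2 + (\<epsilon> powr (3/2) * l2_norm (wderiv 2 p))\<^sup>2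
    + (l2_norm q)\<^sup>2 + (\<epsilon>\<^sup>2 * l2_norm (wderiv 2 q))\<^sup>2"
  using assms by (simp add: power_mult_distrib eps_powr)

lemma bal_norm_nonneg: "0 < \<epsilon> \<Longrightarrow> 0 \<le> bal_norm \<epsilon> (p, q)"
  by simp

lemma bal_norm_components:
  assumes "0 < \<epsilon>"
  shows "l2_norm p \<le> bal_norm \<epsilon> (p, q)" "\<epsilon> powr (3/2) * l2_norm (wderiv 2 p) \<le> bal_norm \<epsilon> (p, q)"
    "l2_norm q \<le> bal_norm \<epsilon> (p, q)" "\<epsilon>\<^sup>2 * l2_norm (wderiv 2 q) \<le> bal_norm \<epsilon> (p, q)"
  by (rule power2_le_imp_le[OF _ bal_norm_nonneg[OF assms]], simp add: bal_norm_sq[OF assms] del: bal_norm.simps)+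

text \<open>With \<open>b = k * \<parallel>p''\<parallel>\<close>, \<open>c = \<parallel>q\<parallel>\<close> and \<open>X = k * \<langle>p'', q\<rangle>\<close>, the indefinite part is
  \<open>lam * (b\<^sup>2 + c\<^sup>2 - 2 * X) + 4 * (1 + \<epsilon>) * X\<close>. Since \<open>2 * \<bar>X\<bar> \<le> b\<^sup>2 + c\<^sup>2\<close>, it is smallest for
  \<open>lam = 3\<close>, where it equals \<open>3 * (b\<^sup>2 + c\<^sup>2) + (4 * \<epsilon> - 2) * X \<ge> 2 * (b\<^sup>2 + c\<^sup>2)\<close>.\<close>
lemma bform_coercive:
  assumes "3 \<le> lam" "0 < \<epsilon>" "\<epsilon> \<le> 1" "p \<in> H02" "q \<in> sobolev 2"
  shows "(bal_norm \<epsilon> (p, q))\<^sup>2 \<le> bform lam \<epsilon> (p, q) (p, q)"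
proof -
  define k where "k = \<epsilon> powr (3/2)"
  have k: "0 < k" using assms by (simp add: k_def)
  define a b c d X where "a = l2_norm p" and "b = k * l2_norm (wderiv 2 p)" and "c = l2_norm q"
    and "d = \<epsilon>\<^sup>2 * l2_norm (wderiv 2 q)" and "X = k * l2_inner (wderiv 2 p) q"
  note S = H02_sobolev[OF assms(4)] assms(5)
  note mem = S[THEN sobolev_L2] S[THEN wderiv_L2[where k=2], simplified]
  have "\<bar>X\<bar> \<le> b * c"
    using mult_left_mono[OF l2_Cauchy_Schwarz[OF mem(3,2)], of k] k
    by (simp add: X_def b_def c_def abs_mult mult.assoc)
  also have "2 * (b * c) \<le> b\<^sup>2 + c\<^sup>2"
    using sum_squares_bound[of b c] by (simp add: mult.assoc)
  finally have X: "2 * \<bar>X\<bar> \<le> b\<^sup>2 + c\<^sup>2" by simp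
  have "l2_inner (wderiv 2 q) p = l2_inner (wderiv 2 p) q"
    using H02_integral_by_parts[OF assms(4,5)] by (simp add: l2_inner_commute)
  then have expand: "bform lam \<epsilon> (p, q) (p, q) = lam * (c\<^sup>2 - 2 * X + b\<^sup>2) + d\<^sup>2 + 4 * \<epsilon> * X + 4 * X + 16 * a\<^sup>2"
    by (subst bform_expand[OF assms(4,5,4,5,2)])
      (simp add: a_def b_def c_def d_def X_def k_def power_mult_distrib l2_norm_sq
        l2_inner_commute[of q "wderiv 2 p"] flip: power_mult)
  have "3 * (c\<^sup>2 - 2 * X + b\<^sup>2) \<le> lam * (c\<^sup>2 - 2 * X + b\<^sup>2)"
    using X assms(1) by (intro mult_right_mono) auto
  moreover have "\<bar>(4 * \<epsilon> - 2) * X\<bar> \<le> 2 * \<bar>X\<bar>"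
    using assms unfolding abs_mult by (intro mult_right_mono) auto
  then have "- (2 * \<bar>X\<bar>) \<le> 4 * \<epsilon> * X - 2 * X"
    unfolding left_diff_distrib by linarith
  moreover have "0 \<le> a\<^sup>2" "0 \<le> b\<^sup>2" "0 \<le> c\<^sup>2"
    by simp_all
  ultimately have "a\<^sup>2 + b\<^sup>2 + c\<^sup>2 + d\<^sup>2 \<le> bform lam \<epsilon> (p, q) (p, q)"
    using X unfolding expand by argo
  then show ?thesis
    unfolding bal_norm_sq[OF assms(2)] by (simp add: a_def b_def c_def d_def k_def)
qed

lemma l2_inner_le_scaled:
  assumes "f \<in> L2" "g \<in> L2" "0 \<le> \<alpha>" "0 \<le> \<beta>" "\<alpha> * l2_norm f \<le> A" "\<beta> * l2_norm g \<le> B"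
  shows "\<bar>\<alpha> * \<beta> * l2_inner f g\<bar> \<le> A * B"
proof -
  have "\<bar>\<alpha> * \<beta> * l2_inner f g\<bar> = \<alpha> * \<beta> * \<bar>l2_inner f g\<bar>"
    using assms by (simp add: abs_mult)
  also have "\<dots> \<le> \<alpha> * \<beta> * (l2_norm f * l2_norm g)"
    using assms by (intro mult_left_mono l2_Cauchy_Schwarz) auto
  also have "\<dots> = (\<alpha> * l2_norm f) * (\<beta> * l2_norm g)"
    by simp
  also have "\<dots> \<le> A * B"
    using assms l2_norm_nonneg[of f] l2_norm_nonneg[of g]
    by (intro mult_mono) (auto intro: order_trans[OF mult_nonneg_nonneg])
  finally show ?thesis .
qed

text \<open>Each of the eight products in the expansion is at most \<open>N * N'\<close> after distributing its weight
  over the two factors; the constant counts their coefficients, \<open>4 * lam + 1 + 4 + 4 + 16\<close>.\<close>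
lemma bform_bounded:
  assumes "0 \<le> lam" "0 < \<epsilon>" "\<epsilon> \<le> 1" "p \<in> H02" "q \<in> sobolev 2" "p' \<in> H02" "q' \<in> sobolev 2"
  shows "\<bar>bform lam \<epsilon> (p, q) (p', q')\<bar> \<le> (4 * lam + 25) * (bal_norm \<epsilon> (p, q) * bal_norm \<epsilon> (p', q'))"
proof -
  define k where "k = \<epsilon> powr (3/2)"
  have k: "0 \<le> k" by (simp add: k_def)
  note S = H02_sobolev[OF assms(4)] assms(5) H02_sobolev[OF assms(6)] assms(7)
  note mem = S[THEN sobolev_L2] S[THEN wderiv_L2[where k=2], simplified]
  define N N' where "N = bal_norm \<epsilon> (p, q)" and "N' = bal_norm \<epsilon> (p', q')"
  have N: "1 * l2_norm p \<le> N" "k * l2_norm (wderiv 2 p) \<le> N" "1 * l2_norm q \<le> N" "\<epsilon>\<^sup>2 * l2_norm (wderiv 2 q) \<le> N"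
    using bal_norm_components[OF assms(2)] by (simp_all add: N_def k_def del: bal_norm.simps)
  have N': "1 * l2_norm p' \<le> N'" "k * l2_norm (wderiv 2 p') \<le> N'" "1 * l2_norm q' \<le> N'" "\<epsilon>\<^sup>2 * l2_norm (wderiv 2 q') \<le> N'"
    using bal_norm_components[OF assms(2)] by (simp_all add: N'_def k_def del: bal_norm.simps)
  (* The weight \<epsilon> * k of the product of wderiv 2 q and p' must be covered by the weight \<epsilon>^2 of wderiv 2 q. *)
  have "k \<le> \<epsilon>"
  proof (rule power2_le_imp_le)
    have "\<epsilon> ^ 3 \<le> \<epsilon> ^ 2"
      using assms by (intro power_decreasing) auto
    then show "k\<^sup>2 \<le> \<epsilon>\<^sup>2"
      using eps_powr(1)[OF assms(2)] by (simp add: k_def)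
  qed (use assms in simp)
  then have "\<epsilon> * k \<le> \<epsilon>\<^sup>2"
    using assms by (simp add: power2_eq_square)
  then have N6: "\<epsilon> * k * l2_norm (wderiv 2 q) \<le> N"
    using N(4) mult_right_mono[OF _ l2_norm_nonneg[of "wderiv 2 q"]] by fastforce
  note bounds = l2_inner_le_scaled[of _ _ _ _ N N']
  have t1: "\<bar>1 * 1 * l2_inner q q'\<bar> \<le> N * N'"
    by (rule bounds) (simp_all add: mem N[simplified] N'[simplified])
  have t2: "\<bar>1 * k * l2_inner q (wderiv 2 p')\<bar> \<le> N * N'"
    by (rule bounds) (simp_all add: mem k N[simplified] N'[simplified])
  have t3: "\<bar>k * 1 * l2_inner (wderiv 2 p) q'\<bar> \<le> N * N'"
    by (rule bounds) (simp_all add: mem k N[simplified] N'[simplified])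
  have t4: "\<bar>k * k * l2_inner (wderiv 2 p) (wderiv 2 p')\<bar> \<le> N * N'"
    by (rule bounds) (simp_all add: mem k N[simplified] N'[simplified])
  have t5: "\<bar>\<epsilon>\<^sup>2 * \<epsilon>\<^sup>2 * l2_inner (wderiv 2 q) (wderiv 2 q')\<bar> \<le> N * N'"
    by (rule bounds) (simp_all add: mem k N[simplified] N'[simplified])
  have t6: "\<bar>(\<epsilon> * k) * 1 * l2_inner (wderiv 2 q) p'\<bar> \<le> N * N'"
    by (rule bounds) (use assms(2) k in \<open>simp_all add: mem N6 N'[simplified]\<close>)
  have t7: "\<bar>1 * 1 * l2_inner p p'\<bar> \<le> N * N'"
    by (rule bounds) (simp_all add: mem k N[simplified] N'[simplified])
  have triangle: "\<bar>x1 + x2 + 4 * x3 + 4 * x4 + 16 * x5\<bar> \<le> L + 25 * P"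
    if "\<bar>x1\<bar> \<le> L" "\<bar>x2\<bar> \<le> P" "\<bar>x3\<bar> \<le> P" "\<bar>x4\<bar> \<le> P" "\<bar>x5\<bar> \<le> P"
    for x1 x2 x3 x4 x5 L P :: real
    using that by linarith
  have "\<bar>lam * (l2_inner q q' - k * l2_inner q (wderiv 2 p') - k * l2_inner (wderiv 2 p) q'
           + k\<^sup>2 * l2_inner (wderiv 2 p) (wderiv 2 p'))\<bar> \<le> lam * (4 * (N * N'))"
    unfolding abs_mult abs_of_nonneg[OF assms(1)]
    by (intro mult_left_mono assms(1)) (use t1 t2 t3 t4 in \<open>simp add: power2_eq_square\<close>)
  moreover have "\<epsilon>\<^sup>2 * \<epsilon>\<^sup>2 = \<epsilon> ^ 4"
    by (simp flip: power_add)
  ultimately have "\<bar>bform lam \<epsilon> (p, q) (p', q')\<bar> \<le> lam * (4 * (N * N')) + 25 * (N * N')"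
    using triangle[OF _ t5 t6 t3 t7]
    unfolding bform_expand[OF assms(4-7,2)] k_def[symmetric] by (simp only: mult_1 mult_1_right mult.assoc)
  also have "\<dots> = (4 * lam + 25) * (N * N')"
    by (simp add: algebra_simps)
  finally show ?thesis
    by (simp add: N_def N'_def)
qed

section \<open>Quasi-optimality\<close>

lemma sobolev4_second_deriv:
  assumes "u \<in> sobolev 4"
  shows "weak_deriv 2 (\<lambda>x. c * wderiv 2 u x) (\<lambda>x. c * wderiv 4 u x)"
    and "(\<lambda>x. c * wderiv 2 u x) \<in> sobolev 2"
proof -
  have "weak_deriv (2 + 2) u (wderiv 4 u)" "weak_deriv 2 u (wderiv 2 u)"
    using sobolev_weak_deriv[OF assms, of 4] sobolev_weak_deriv[OF assms, of 2] by simp_all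
  from weak_deriv_weak_deriv[OF this(2,1)]
  show "weak_deriv 2 (\<lambda>x. c * wderiv 2 u x) (\<lambda>x. c * wderiv 4 u x)"
    by (rule weak_deriv_cmult)
  show "(\<lambda>x. c * wderiv 2 u x) \<in> sobolev 2"
    using sobolev_wderiv[of u 2 2] assms by (simp add: sobolev_cmult)
qed

text \<open>The first residual of the exact pair vanishes, and the second one is the left-hand side of the
  differential equation.\<close>
lemma bform_consistent:
  assumes "0 < \<epsilon>" "f \<in> L2" "bvp_solution \<epsilon> f u" "p \<in> sobolev 2" "q \<in> sobolev 2"
  shows "bform lam \<epsilon> (u, \<lambda>x. \<epsilon> powr (3/2) * wderiv 2 u x) (p, q) = fform \<epsilon> f (p, q)"
proof -
  define v where "v = (\<lambda>x. \<epsilon> powr (3/2) * wderiv 2 u x)"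
  have u: "u \<in> sobolev 4" "u \<in> H02" "AE x in M. \<epsilon> ^ 4 * wderiv 4 u x + 4 * u x = f x"
    using assms(3) by (auto simp: bvp_solution_def)
  note v = sobolev4_second_deriv[OF u(1), of "\<epsilon> powr (3/2)", folded v_def]
  have eps: "\<epsilon> powr (5/2) * \<epsilon> powr (3/2) = \<epsilon> ^ 4"
    using eps_powr[OF assms(1)] by (simp add: power2_eq_square power_numeral_reduce mult.assoc)
  have "l2_inner (\<lambda>x. \<epsilon> powr (5/2) * wderiv 2 v x + 4 * u x) (\<lambda>x. \<epsilon> powr (3/2) * wderiv 2 q x + 4 * p x)
      = l2_inner f (\<lambda>x. \<epsilon> powr (3/2) * wderiv 2 q x + 4 * p x)"
  proof (rule l2_inner_cong_AE)
    show "AE x in M. \<epsilon> powr (5/2) * wderiv 2 v x + 4 * u x = f x"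
      using wderiv_AE[OF v(1)] u(3)
      by eventually_elim (simp add: eps flip: mult.assoc)
    show "(\<lambda>x. \<epsilon> powr (5/2) * wderiv 2 v x + 4 * u x) \<in> L2"
      using residual_L2[OF v(2) H02_sobolev[OF u(2)]] by (simp add: residual_def[abs_def])
    show "(\<lambda>x. \<epsilon> powr (3/2) * wderiv 2 q x + 4 * p x) \<in> L2"
      using residual_L2[OF assms(5,4)] by (simp add: residual_def[abs_def])
    then show "(\<lambda>x. \<epsilon> powr (3/2) * wderiv 2 q x + 4 * p x) \<in> L2" .
  qed (simp_all add: assms)
  moreover have "(\<lambda>x. v x - \<epsilon> powr (3/2) * wderiv 2 u x) = (\<lambda>x. 0)"
    by (simp add: v_def)
  moreover have "l2_inner (\<lambda>x. 0) g = 0" for g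
    by (simp add: l2_inner_def)
  ultimately have "bform lam \<epsilon> (u, v) (p, q) = fform \<epsilon> f (p, q)"
    by simp
  then show ?thesis
    by (simp only: v_def)
qed

text \<open>Cea's argument. With the error \<open>e\<close>, the approximation error \<open>g\<close> and their difference \<open>d\<close> in the
  discrete space, orthogonality of \<open>e\<close> and \<open>d\<close> gives
  \<open>\<parallel>e\<parallel>\<^sup>2 \<le> bform (e, e) = bform (e, g) \<le> (4 * lam + 25) * \<parallel>e\<parallel> * \<parallel>g\<parallel>\<close>.\<close>
lemma quasi_optimality:
  assumes "3 \<le> lam" "0 < \<epsilon>" "\<epsilon> \<le> 1"
    and Vu: "Vu \<subseteq> H02" "fin_dim_subspace Vu" and Vv: "Vv \<subseteq> sobolev 2" "fin_dim_subspace Vv"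
    and u: "u \<in> H02" and v: "v \<in> sobolev 2"
    and h: "uh \<in> Vu" "vh \<in> Vv" and s: "us \<in> Vu" "vs \<in> Vv"
    and galerkin: "\<And>p q. p \<in> Vu \<Longrightarrow> q \<in> Vv \<Longrightarrow> bform lam \<epsilon> (u, v) (p, q) = bform lam \<epsilon> (uh, vh) (p, q)"
  shows "bal_norm \<epsilon> (\<lambda>x. u x - uh x, \<lambda>x. v x - vh x)
    \<le> (4 * lam + 25) * bal_norm \<epsilon> (\<lambda>x. u x - us x, \<lambda>x. v x - vs x)"
proof -
  define eu ev gu gv du dv where "eu = (\<lambda>x. u x - uh x)" and "ev = (\<lambda>x. v x - vh x)"
    and "gu = (\<lambda>x. u x - us x)" and "gv = (\<lambda>x. v x - vs x)"
    and "du = (\<lambda>x. us x - uh x)" and "dv = (\<lambda>x. vs x - vh x)"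
  have d: "du \<in> Vu" "dv \<in> Vv"
    unfolding du_def dv_def using Vu Vv h s by (auto intro: fin_dim_subspace_diff)
  have mem: "uh \<in> H02" "us \<in> H02" "vh \<in> sobolev 2" "vs \<in> sobolev 2" "du \<in> sobolev 2" "dv \<in> sobolev 2"
    using d Vu Vv h s by (auto intro: H02_sobolev)
  have e: "eu \<in> H02" "ev \<in> sobolev 2" and g: "gu \<in> H02" "gv \<in> sobolev 2"
    unfolding eu_def ev_def gu_def gv_def by (intro H02_diff sobolev_diff u v mem)+
  have "bform lam \<epsilon> (eu, ev) (du, dv) = bform lam \<epsilon> (u, v) (du, dv) - bform lam \<epsilon> (uh, vh) (du, dv)"
    unfolding eu_def ev_def by (intro bform_diff_left mem v H02_sobolev u)
  then have orth: "bform lam \<epsilon> (eu, ev) (du, dv) = 0"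
    using galerkin[OF d] by simp
  have "gu = (\<lambda>x. eu x - du x)" "gv = (\<lambda>x. ev x - dv x)"
    by (simp_all add: gu_def gv_def eu_def ev_def du_def dv_def)
  then have "bform lam \<epsilon> (eu, ev) (gu, gv) = bform lam \<epsilon> (eu, ev) (eu, ev)"
    using bform_diff_right[of eu ev eu ev du dv lam \<epsilon>] e mem orth
    by (simp add: H02_sobolev del: bform.simps)
  then have "(bal_norm \<epsilon> (eu, ev))\<^sup>2 \<le> \<bar>bform lam \<epsilon> (eu, ev) (gu, gv)\<bar>"
    using bform_coercive[OF assms(1-3) e] by (simp del: bform.simps bal_norm.simps)
  also have "\<dots> \<le> (4 * lam + 25) * (bal_norm \<epsilon> (eu, ev) * bal_norm \<epsilon> (gu, gv))"
    by (rule bform_bounded) (use assms(1-3) e g in auto)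
  finally have "bal_norm \<epsilon> (eu, ev) * bal_norm \<epsilon> (eu, ev)
      \<le> bal_norm \<epsilon> (eu, ev) * ((4 * lam + 25) * bal_norm \<epsilon> (gu, gv))"
    by (simp add: power2_eq_square mult_ac del: bal_norm.simps)
  then have "bal_norm \<epsilon> (eu, ev) \<le> (4 * lam + 25) * bal_norm \<epsilon> (gu, gv)" 
    if "0 < bal_norm \<epsilon> (eu, ev)"
    using that by (simp del: bal_norm.simps)
  moreover have "0 \<le> (4 * lam + 25) * bal_norm \<epsilon> (gu, gv)"
    using bal_norm_nonneg[OF assms(2)] assms(1) by (intro mult_nonneg_nonneg) auto
  ultimately have "bal_norm \<epsilon> (eu, ev) \<le> (4 * lam + 25) * bal_norm \<epsilon> (gu, gv)"
    by (meson not_le order_trans)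
  then show ?thesis
    by (simp only: eu_def ev_def gu_def gv_def)
qed

lemma bal_norm_le_sum:
  assumes "0 < \<epsilon>"
  shows "bal_norm \<epsilon> (p, q) \<le> l2_norm p + \<epsilon> powr (3/2) * l2_norm (wderiv 2 p)
    + (l2_norm q + \<epsilon>\<^sup>2 * l2_norm (wderiv 2 q))"
proof -
  define a b c d where "a = l2_norm p" and "b = \<epsilon> powr (3/2) * l2_norm (wderiv 2 p)"
    and "c = l2_norm q" and "d = \<epsilon>\<^sup>2 * l2_norm (wderiv 2 q)"
  have nn: "0 \<le> a" "0 \<le> b" "0 \<le> c" "0 \<le> d"
    by (auto simp: a_def b_def c_def d_def l2_norm_nonneg)
  have "(bal_norm \<epsilon> (p, q))\<^sup>2 = a\<^sup>2 + b\<^sup>2 + c\<^sup>2 + d\<^sup>2"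
    unfolding bal_norm_sq[OF assms] by (simp add: a_def b_def c_def d_def)
  also have "\<dots> \<le> (a + b)\<^sup>2 + (c + d)\<^sup>2"
    using nn by (simp add: power2_sum)
  also have "\<dots> \<le> (a + b + (c + d))\<^sup>2"
    using nn by (simp add: power2_sum)
  finally have "bal_norm \<epsilon> (p, q) \<le> a + b + (c + d)"
    by (rule power2_le_imp_le) (use nn in simp)
  then show ?thesis
    by (simp only: a_def b_def c_def d_def)
qed

text \<open>Choosing \<open>\<epsilon> powr (3/2) * vs\<close> as second component lets the factor \<open>\<epsilon> powr (3/2)\<close> be taken out
  of both norms of that component; the second derivative of the error there is the
  fourth derivative of \<open>u\<close>.\<close>
lemma bal_norm_error_le:
  assumes "0 < \<epsilon>" "u \<in> sobolev 4" "vs \<in> sobolev 2"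
  shows "bal_norm \<epsilon> (\<lambda>x. u x - us x, \<lambda>x. \<epsilon> powr (3/2) * wderiv 2 u x - \<epsilon> powr (3/2) * vs x)
    \<le> l2_norm (\<lambda>x. u x - us x) + \<epsilon> powr (3/2) * l2_norm (wderiv 2 (\<lambda>x. u x - us x))
      + \<epsilon> powr (3/2) * (l2_norm (\<lambda>x. wderiv 2 u x - vs x) + \<epsilon>\<^sup>2 * l2_norm (\<lambda>x. wderiv 4 u x - wderiv 2 vs x))"
proof -
  let ?k = "\<epsilon> powr (3/2)"
  let ?q = "\<lambda>x. ?k * wderiv 2 u x - ?k * vs x"
  have vs: "weak_deriv 2 (\<lambda>x. ?k * vs x) (\<lambda>x. ?k * wderiv 2 vs x)"
    using assms(3) by (intro weak_deriv_cmult sobolev_weak_deriv[of _ 2]) auto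
  note wd = weak_deriv_diff[OF sobolev4_second_deriv(1)[OF assms(2), of ?k] vs]
  have "l2_norm ?q = l2_norm (\<lambda>x. ?k * (wderiv 2 u x - vs x))"
    by (simp add: right_diff_distrib)
  then have 1: "l2_norm ?q = ?k * l2_norm (\<lambda>x. wderiv 2 u x - vs x)"
    by (simp add: l2_norm_cmult)
  have "l2_norm (wderiv 2 ?q) = l2_norm (\<lambda>x. ?k * wderiv 4 u x - ?k * wderiv 2 vs x)"
    by (rule l2_norm_cong_AE[OF wderiv_AE[OF wd] weak_derivD(2)[OF weak_deriv_wderiv[OF wd]] weak_derivD(2)[OF wd]])
  also have "\<dots> = l2_norm (\<lambda>x. ?k * (wderiv 4 u x - wderiv 2 vs x))"
    by (simp add: right_diff_distrib)
  finally have 2: "l2_norm (wderiv 2 ?q) = ?k * l2_norm (\<lambda>x. wderiv 4 u x - wderiv 2 vs x)"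
    by (simp add: l2_norm_cmult)
  show ?thesis
    using bal_norm_le_sum[OF assms(1), of "\<lambda>x. u x - us x" ?q]
    by (simp add: 1 2 distrib_left mult.left_commute del: bal_norm.simps)
qed

lemma INF_le_add_INF:
  fixes F :: "'a \<times> 'b \<Rightarrow> real"
  assumes "A \<noteq> {}" "B \<noteq> {}" "0 < k"
    and lower: "\<And>z. z \<in> A \<times> B \<Longrightarrow> 0 \<le> F z"
    and bound: "\<And>a b. a \<in> A \<Longrightarrow> b \<in> B \<Longrightarrow> \<exists>z\<in>A \<times> B. F z \<le> f a + k * g b"
  shows "(INF z\<in>A \<times> B. F z) \<le> (INF a\<in>A. f a) + k * (INF b\<in>B. g b)"
proof -
  define I where "I = (INF z\<in>A \<times> B. F z)"
  have I: "I \<le> f a + k * g b" if ab: "a \<in> A" "b \<in> B" for a b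
  proof -
    obtain z where z: "z \<in> A \<times> B" "F z \<le> f a + k * g b"
      using bound[OF ab] by blast
    have "I \<le> F z"
      unfolding I_def using lower z(1) by (intro cINF_lower bdd_belowI2[of _ 0]) auto
    with z show ?thesis by simp
  qed
  have "I - k * g b \<le> (INF a\<in>A. f a)" if "b \<in> B" for b
    using assms(1) I[OF _ that] by (intro cINF_greatest) (auto simp: algebra_simps)
  then have "(I - (INF a\<in>A. f a)) / k \<le> (INF b\<in>B. g b)"
    using assms(2,3) by (intro cINF_greatest) (auto simp: field_simps)
  then show ?thesis
    using assms(3) by (simp add: field_simps I_def)
qed

theorem proposition3:
  fixes lam :: real
  assumes "lam \<ge> 3"
  shows "\<exists>C>0. \<forall>\<epsilon> f u Vu Vv uh vh.
    0 < \<epsilon> \<and> \<epsilon> \<le> 1 \<and> f \<in> L2 \<and> bvp_solution \<epsilon> f u \<and>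
    Vu \<subseteq> H02 \<and> fin_dim_subspace Vu \<and> Vv \<subseteq> sobolev 2 \<and> fin_dim_subspace Vv \<and>
    (uh, vh) \<in> Vu \<times> Vv \<and>
    (\<forall>(us, vs) \<in> Vu \<times> Vv. bform lam \<epsilon> (uh, vh) (us, vs) = fform \<epsilon> f (us, vs))
    \<longrightarrow>
    bal_norm \<epsilon> (\<lambda>x. u x - uh x, \<lambda>x. \<epsilon> powr (3/2) * wderiv 2 u x - vh x)
      \<le> C * (INF (us, vs)\<in>Vu \<times> Vv.
            bal_norm \<epsilon> (\<lambda>x. u x - us x, \<lambda>x. \<epsilon> powr (3/2) * wderiv 2 u x - vs x))
    \<and>
    C * (INF (us, vs)\<in>Vu \<times> Vv.
          bal_norm \<epsilon> (\<lambda>x. u x - us x, \<lambda>x. \<epsilon> powr (3/2) * wderiv 2 u x - vs x))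
      \<le> C * (INF us\<in>Vu. l2_norm (\<lambda>x. u x - us x)
                + \<epsilon> powr (3/2) * l2_norm (wderiv 2 (\<lambda>x. u x - us x)))
        + C * \<epsilon> powr (3/2) * (INF vs\<in>Vv. l2_norm (\<lambda>x. wderiv 2 u x - vs x)
                + \<epsilon>\<^sup>2 * l2_norm (\<lambda>x. wderiv 4 u x - wderiv 2 vs x))"
proof (intro exI[of _ "4 * lam + 25"] conjI allI impI, goal_cases)
  case 1
  show ?case using assms by simp
next
  case (2 \<epsilon> f u Vu Vv uh vh)
  define v where "v = (\<lambda>x. \<epsilon> powr (3/2) * wderiv 2 u x)"
  from 2 have eps: "0 < \<epsilon>" "\<epsilon> \<le> 1" and f: "f \<in> L2" "bvp_solution \<epsilon> f u"
    and Vu: "Vu \<subseteq> H02" "fin_dim_subspace Vu" and Vv: "Vv \<subseteq> sobolev 2" "fin_dim_subspace Vv"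
    and h: "uh \<in> Vu" "vh \<in> Vv"
    and galerkin: "\<And>p q. p \<in> Vu \<Longrightarrow> q \<in> Vv \<Longrightarrow> bform lam \<epsilon> (uh, vh) (p, q) = fform \<epsilon> f (p, q)"
    by blast+
  have u: "u \<in> sobolev 4" "u \<in> H02"
    using f(2) by (auto simp: bvp_solution_def)
  have v: "v \<in> sobolev 2"
    unfolding v_def by (rule sobolev4_second_deriv(2)[OF u(1)])
  have orth: "bform lam \<epsilon> (u, v) (p, q) = bform lam \<epsilon> (uh, vh) (p, q)" if "p \<in> Vu" "q \<in> Vv" for p q
    using bform_consistent[OF eps(1) f, of p q lam] galerkin[OF that] that Vu Vv H02_sobolev
    unfolding v_def by fastforce
  have "bal_norm \<epsilon> (\<lambda>x. u x - uh x, \<lambda>x. v x - vh x) / (4 * lam + 25)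
      \<le> (INF (us, vs)\<in>Vu \<times> Vv. bal_norm \<epsilon> (\<lambda>x. u x - us x, \<lambda>x. v x - vs x))"
  proof (rule cINF_greatest)
    show "Vu \<times> Vv \<noteq> {}"
      using h by auto
    fix z assume "z \<in> Vu \<times> Vv"
    then obtain us vs where z: "z = (us, vs)" "us \<in> Vu" "vs \<in> Vv"
      by auto
    show "bal_norm \<epsilon> (\<lambda>x. u x - uh x, \<lambda>x. v x - vh x) / (4 * lam + 25)
        \<le> (case z of (us, vs) \<Rightarrow> bal_norm \<epsilon> (\<lambda>x. u x - us x, \<lambda>x. v x - vs x))"
      using quasi_optimality[OF assms eps Vu Vv u(2) v h z(2,3) orth] assms z(1)
      by (simp add: divide_le_eq mult.commute del: bal_norm.simps bform.simps)
  qed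
  then show ?case
    using assms by (simp add: divide_le_eq mult.commute v_def del: bal_norm.simps)
next
  case (3 \<epsilon> f u Vu Vv uh vh)
  then have eps: "0 < \<epsilon>" and u: "u \<in> sobolev 4"
    and Vu: "Vu \<subseteq> H02" and Vv: "Vv \<subseteq> sobolev 2" "fin_dim_subspace Vv" and h: "uh \<in> Vu" "vh \<in> Vv"
    by (auto simp: bvp_solution_def)
  let ?k = "\<epsilon> powr (3/2)"
  let ?F = "\<lambda>(us, vs). bal_norm \<epsilon> (\<lambda>x. u x - us x, \<lambda>x. ?k * wderiv 2 u x - vs x)"
  let ?f = "\<lambda>us. l2_norm (\<lambda>x. u x - us x) + ?k * l2_norm (wderiv 2 (\<lambda>x. u x - us x))"
  let ?g = "\<lambda>vs. l2_norm (\<lambda>x. wderiv 2 u x - vs x) + \<epsilon>\<^sup>2 * l2_norm (\<lambda>x. wderiv 4 u x - wderiv 2 vs x)"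
  have "(INF z\<in>Vu \<times> Vv. ?F z) \<le> (INF us\<in>Vu. ?f us) + ?k * (INF vs\<in>Vv. ?g vs)"
  proof (rule INF_le_add_INF)
    show "Vu \<noteq> {}" "Vv \<noteq> {}" "0 < ?k"
      using h eps by auto
    show "0 \<le> ?F z" for z
      using bal_norm_nonneg[OF eps] by (auto simp: case_prod_beta)
    fix us vs assume s: "us \<in> Vu" "vs \<in> Vv"
    have mem: "(us, \<lambda>x. ?k * vs x) \<in> Vu \<times> Vv"
      using s Vv(2) by (auto simp: fin_dim_subspace_def)
    have "?F (us, \<lambda>x. ?k * vs x) \<le> ?f us + ?k * ?g vs"
      using bal_norm_error_le[OF eps u, of vs us] s Vv(1) by (auto simp del: bal_norm.simps)
    then show "\<exists>z\<in>Vu \<times> Vv. ?F z \<le> ?f us + ?k * ?g vs"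
      by (rule bexI[OF _ mem])
  qed
  then have "(4 * lam + 25) * (INF z\<in>Vu \<times> Vv. ?F z)
      \<le> (4 * lam + 25) * ((INF us\<in>Vu. ?f us) + ?k * (INF vs\<in>Vv. ?g vs))"
    using assms by (intro mult_left_mono) auto
  then show ?case
    by (simp only: distrib_left mult.assoc)
qed

end
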